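(* Let $1\le k\le n$ and $\ell\ge 1$ be integers, let $\ell'=\gcd(\ell,n)$ and $p=\frac{n}{\ell'}$. Then the cyclic symmetry locus is a disjoint union $$\mathrm{Gr}(k,n)^{\rho^\ell}=\coprod_{\substack{m_1,\dots,m_p\in\{0,1,\dots,\ell'\}\\ \sum_i m_i=k}}\mathrm{Gr}(m_1,\ell')\times\mathrm{Gr}(m_2,\ell')\times\cdots\times\mathrm{Gr}(m_p,\ell'),$$ i.e. it is the disjoint union of subvarieties indexed by the tuples $(m_1,\dots,m_p)$, the one indexed by $(m_1,\dots,m_p)$ being isomorphic to $\prod_{i=1}^p\mathrm{Gr}(m_i,\ell')$.
   Context: $\mathrm{Gr}(k,n)$ is the Grassmannian of $k$-dimensional subspaces of $\mathbb{C}^n$, viewed as row spans of $k\times n$ matrices, embedded in projective space by the Plücker coordinates $\Delta_I$, $I\in\binom{[n]}{k}$. The cyclic shift $\rho\in\mathrm{Aut}(\mathrm{Gr}(k,n))$ sends the row span of the matrix with columns $(v_1,\dots,v_n)$ to the row span of the matrix with columns $(v_2,\dots,v_n,(-1)^{k-1}v_1)$; thus $\rho^*\Delta_I=\Delta_{\rho(I)}$, where $\rho(I)$ is obtained by adding $1$ to every element of $I$ modulo $n$. $\mathrm{Gr}(k,n)^{\rho^\ell}=\{X:\rho^\ell(X)=X\}$. $\mathrm{Gr}(0,\ell')$ and $\mathrm{Gr}(\ell',\ell')$ are single points. *)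

theory Defs
  imports
    "HOL-Analysis.Abstract_Topology"
    "Jordan_Normal_Form.DL_Submatrix"
    "Jordan_Normal_Form.VS_Connect"
begin

section \<open>Grassmannians and the cyclic shift\<close>

abbreviation row_span :: "nat \<Rightarrow> complex mat \<Rightarrow> complex vec set" where
  "row_span n \<equiv> vec_space.row_space n"

definition Gr :: "nat \<Rightarrow> nat \<Rightarrow> complex vec set set" where
  "Gr k n = {W. VectorSpace.subspace class_ring W (module_vec TYPE(complex) n) \<and>
     vectorspace.dim class_ring (module_vec TYPE(complex) n\<lparr>carrier := W\<rparr>) = k}"

text \<open>Columns are numbered from 0, so column \<open>v\<^sub>j\<close> is \<open>col A (j - 1)\<close>. The shift is given on
  row vectors, and \<open>cyc_shift_row_span\<close> below turns it into the shift on the columns of a matrix.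
  The exponent \<open>k - 1\<close> is natural subtraction, hence only meaningful for \<open>k \<ge> 1\<close>.\<close>

definition shift_vec :: "nat \<Rightarrow> nat \<Rightarrow> complex vec \<Rightarrow> complex vec" where
  "shift_vec k n x = vec n (\<lambda>j. if Suc j < n then x $ Suc j else (-1) ^ (k - 1) * x $ 0)"

definition cyc_shift :: "nat \<Rightarrow> nat \<Rightarrow> complex vec set \<Rightarrow> complex vec set" where
  "cyc_shift k n W = shift_vec k n ` W"

definition shift_mat :: "nat \<Rightarrow> nat \<Rightarrow> complex mat \<Rightarrow> complex mat" where
  "shift_mat k n A = mat_of_cols (dim_row A)
     (map (\<lambda>j. col A (Suc j)) [0..<n - 1] @ [(-1) ^ (k - 1) \<cdot>\<^sub>v col A 0])"

lemma row_span_eq: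
  assumes "A \<in> carrier_mat k n"
  shows "row_span n A = {transpose_mat A *\<^sub>v y | y. y \<in> carrier_vec k}"
proof -
  have "row_span n A = {w \<in> carrier_vec (dim_col A).
      \<exists>y\<in>carrier_vec (dim_row A). transpose_mat A *\<^sub>v y = w}"
    using vec_space.row_space_eq[OF assms] .
  then show ?thesis using assms by (auto intro!: mult_mat_vec_carrier)
qed

lemma cyc_shift_row_span:
  assumes A: "A \<in> carrier_mat k n" and n: "n \<ge> 1"
  shows "cyc_shift k n (row_span n A) = row_span n (shift_mat k n A)"
proof -
  have S: "shift_mat k n A \<in> carrier_mat k n"
    using A n by (auto simp: shift_mat_def)
  have *: "shift_vec k n (transpose_mat A *\<^sub>v y) = transpose_mat (shift_mat k n A) *\<^sub>v y"
    if y: "y \<in> carrier_vec k" for y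
  proof (rule eq_vecI)
    fix j assume "j < dim_vec (transpose_mat (shift_mat k n A) *\<^sub>v y)"
    then have j: "j < n" using S by simp
    have col: "col (shift_mat k n A) j =
        (if Suc j < n then col A (Suc j) else (-1) ^ (k - 1) \<cdot>\<^sub>v col A 0)"
      using A j n unfolding shift_mat_def
      by (subst col_mat_of_cols) (auto simp: nth_append)
    show "shift_vec k n (transpose_mat A *\<^sub>v y) $ j = (transpose_mat (shift_mat k n A) *\<^sub>v y) $ j"
      using A S j n y by (auto simp: shift_vec_def col smult_scalar_prod_distrib[of _ k])
  qed (use S in \<open>simp add: shift_vec_def\<close>)
  show ?thesis
    unfolding cyc_shift_def row_span_eq[OF A] row_span_eq[OF S]
    using * by (auto simp: image_iff) (metis *)
qed

section \<open>Subvarieties of products of projective spaces\<close>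

text \<open>A point of a projective space is the set of its homogeneous coordinate vectors, and a point of
  \<open>P\<^sub>0 \<times> \<dots> \<times> P\<^bsub>p-1\<^esub>\<close> is a list of \<open>p\<close> such points, so that the product of the varieties \<open>V\<^sub>i \<subseteq> P\<^sub>i\<close>
  is the library's \<open>listset [V\<^sub>0, \<dots>, V\<^bsub>p-1\<^esub>]\<close>.\<close>

type_synonym 'v proj = "('v \<Rightarrow> complex) set"

definition proj_pt :: "('v \<Rightarrow> complex) \<Rightarrow> 'v proj" where
  "proj_pt z = {(\<lambda>v. c * z v) | c. c \<noteq> 0}"

text \<open>The systems of homogeneous coordinates of a point of the product, one vector per factor.
  They are continued by 0, so that forms need not be restricted to the factors that occur.\<close>

definition hcoords :: "'v proj list \<Rightarrow> (nat \<Rightarrow> 'v \<Rightarrow> complex) set" where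
  "hcoords xs = {z. (\<forall>i<length xs. z i \<in> xs ! i) \<and> (\<forall>i\<ge>length xs. z i = (\<lambda>_. 0))}"

text \<open>Polynomial functions in the coordinates \<open>z i v\<close> that are homogeneous of degree \<open>d i\<close> in the
  \<open>i\<close>-th block of variables, for every \<open>i\<close>.\<close>

inductive multiform :: "(nat \<Rightarrow> nat) \<Rightarrow> ((nat \<Rightarrow> 'v \<Rightarrow> complex) \<Rightarrow> complex) \<Rightarrow> bool" where
  const: "multiform (\<lambda>_. 0) (\<lambda>z. a)"
| coord: "multiform ((\<lambda>_. 0)(i := 1)) (\<lambda>z. z i v)"
| add: "multiform d f \<Longrightarrow> multiform d g \<Longrightarrow> multiform d (\<lambda>z. f z + g z)"
| mult: "multiform d f \<Longrightarrow> multiform e g \<Longrightarrow> multiform (\<lambda>i. d i + e i) (\<lambda>z. f z * g z)"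

text \<open>Whether a multihomogeneous form vanishes at a point does not depend on the coordinates chosen.
  Open sets are the complements in \<open>V\<close> of the common zero sets of families \<open>F\<close> of forms.\<close>

definition zariski :: "'v proj list set \<Rightarrow> 'v proj list topology" where
  "zariski V = topology (\<lambda>U. \<exists>F. (\<forall>f\<in>F. \<exists>d. multiform d f) \<and>
     U = {x \<in> V. \<exists>f\<in>F. \<forall>z\<in>hcoords x. f z \<noteq> 0})"

lemma openin_zariski:
  "openin (zariski V) U \<longleftrightarrow> (\<exists>F. (\<forall>f\<in>F. \<exists>d. multiform d f) \<and>
     U = {x \<in> V. \<exists>f\<in>F. \<forall>z\<in>hcoords x. f z \<noteq> 0})"
proof -
  let ?O = "\<lambda>F. {x \<in> V. \<exists>f\<in>F. \<forall>z\<in>hcoords x. f z \<noteq> 0}"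
  let ?P = "\<lambda>U. \<exists>F. (\<forall>f\<in>F. \<exists>d. multiform d f) \<and> U = ?O F"
  have "istopology ?P"
    unfolding istopology_def
  proof (intro conjI allI impI)
    fix S T assume "?P S" "?P T"
    then obtain F G where F: "\<forall>f\<in>F. \<exists>d. multiform d f" "S = ?O F"
      and G: "\<forall>f\<in>G. \<exists>d. multiform d f" "T = ?O G" by blast
    let ?H = "{(\<lambda>z. f z * g z) | f g. f \<in> F \<and> g \<in> G}"
    have "\<forall>f\<in>?H. \<exists>d. multiform d f" using F(1) G(1) by (blast intro: multiform.mult)
    moreover have "S \<inter> T = ?O ?H"
    proof (intro equalityI subsetI)
      fix x assume "x \<in> S \<inter> T"
      then obtain f g where fg: "f \<in> F" "g \<in> G" and x: "x \<in> V"
        and nz: "\<forall>z\<in>hcoords x. f z \<noteq> 0" "\<forall>z\<in>hcoords x. g z \<noteq> 0"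
        using F(2) G(2) by blast
      have "(\<lambda>z. f z * g z) \<in> ?H" using fg by blast
      moreover have "\<forall>z\<in>hcoords x. f z * g z \<noteq> 0" using nz by simp
      ultimately have "\<exists>h\<in>?H. \<forall>z\<in>hcoords x. h z \<noteq> 0"
        by (intro bexI[where x = "\<lambda>z. f z * g z"])
      then show "x \<in> ?O ?H" using x by simp
    next
      fix x assume "x \<in> ?O ?H"
      then obtain f g where "x \<in> V" "f \<in> F" "g \<in> G" "\<forall>z\<in>hcoords x. f z * g z \<noteq> 0" by blast
      then have "x \<in> ?O F" "x \<in> ?O G" by auto
      then show "x \<in> S \<inter> T" using F(2) G(2) by blast
    qed
    ultimately show "?P (S \<inter> T)" by blast
  next
    fix K assume "\<forall>U\<in>K. ?P U"
    from bchoice[OF this] obtain F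
      where F: "\<forall>U\<in>K. (\<forall>f\<in>F U. \<exists>d. multiform d f) \<and> U = ?O (F U)" ..
    have "\<Union>K = \<Union>((\<lambda>U. ?O (F U)) ` K)"
      using F by (metis (no_types, lifting) image_cong image_ident)
    also have "\<dots> = ?O (\<Union>(F ` K))" by blast
    finally have "\<Union>K = ?O (\<Union>(F ` K))" .
    moreover have "\<forall>f\<in>\<Union>(F ` K). \<exists>d. multiform d f" using F by blast
    ultimately show "?P (\<Union>K)" by (intro exI[of _ "\<Union>(F ` K)"] conjI)
  qed
  then show ?thesis by (simp add: zariski_def)
qed

lemma topspace_zariski [simp]: "topspace (zariski V) = V"
proof
  show "topspace (zariski V) \<subseteq> V"
    unfolding topspace_def openin_zariski by blast
  have "openin (zariski V) V"
    unfolding openin_zariski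
    by (rule exI[of _ "{\<lambda>z. 1}"]) (auto intro: multiform.const)
  then show "V \<subseteq> topspace (zariski V)" by (rule openin_subset)
qed

definition regular_on :: "'v proj list set \<Rightarrow> 'v proj list set \<Rightarrow> ('v proj list \<Rightarrow> complex) \<Rightarrow> bool" where
  "regular_on V U h \<longleftrightarrow> openin (zariski V) U \<and>
     (\<forall>x\<in>U. \<exists>U' d f g. openin (zariski V) U' \<and> x \<in> U' \<and> U' \<subseteq> U \<and>
        multiform d f \<and> multiform d g \<and>
        (\<forall>y\<in>U'. \<forall>z\<in>hcoords y. g z \<noteq> 0 \<and> h y = f z / g z))"

definition variety_morphism ::
  "'v proj list set \<Rightarrow> 'w proj list set \<Rightarrow> ('v proj list \<Rightarrow> 'w proj list) \<Rightarrow> bool" where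
  "variety_morphism V W \<phi> \<longleftrightarrow> continuous_map (zariski V) (zariski W) \<phi> \<and>
     (\<forall>U h. regular_on W U h \<longrightarrow> regular_on V {x \<in> V. \<phi> x \<in> U} (h \<circ> \<phi>))"

definition variety_isomorphic :: "'v proj list set \<Rightarrow> 'w proj list set \<Rightarrow> bool" where
  "variety_isomorphic V W \<longleftrightarrow> (\<exists>\<phi> \<psi>. variety_morphism V W \<phi> \<and> variety_morphism W V \<psi> \<and>
     (\<forall>x\<in>V. \<psi> (\<phi> x) = x) \<and> (\<forall>y\<in>W. \<phi> (\<psi> y) = y))"

section \<open>The Pluecker embedding\<close>

definition plucker_coord :: "complex mat \<Rightarrow> nat set \<Rightarrow> complex" where
  "plucker_coord A I =
     (if I \<subseteq> {..<dim_col A} \<and> card I = dim_row A then det (submatrix A UNIV I) else 0)"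

text \<open>All matrices with row span \<open>W\<close> give the same point, so the union is over equal sets.\<close>

definition plucker :: "nat \<Rightarrow> nat \<Rightarrow> complex vec set \<Rightarrow> nat set proj" where
  "plucker k n W = (\<Union>A\<in>{A \<in> carrier_mat k n. row_span n A = W}. proj_pt (plucker_coord A))"

end

theory Submission
  imports Defs "Jordan_Normal_Form.DL_Rank"
begin

text \<open>
  Put \<open>q = gcd l n\<close> and \<open>p = n / q\<close>. Since the \<open>n\<close>-th power of the shift is the sign
  \<open>(-1)\<^bsup>k-1\<^esup>\<close>, its \<open>q\<close>-th power is diagonalised by the \<open>p\<close> distinct \<open>p\<close>-th roots of that sign,
  each with an eigenspace of dimension \<open>q\<close>, and the \<open>l\<close>-th power, which is the \<open>l/q\<close>-th power
  of that operator, still has distinct eigenvalues because \<open>l/q\<close> is coprime to \<open>p\<close>. A fixed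
  subspace is therefore the sum of its intersections with the \<open>p\<close> eigenspaces, and \<open>m\<^sub>i\<close> is the
  dimension of the \<open>i\<close>-th intersection.

  In Pluecker coordinates with respect to an eigenbasis, split into \<open>p\<close> blocks of size \<open>q\<close>, the
  stratum of \<open>m\<close> is cut out by the vanishing of the coordinates of all \<open>J\<close> that do not have exactly
  \<open>m\<^sub>i\<close> elements in each block \<open>i\<close>. Row reduction turns a matrix satisfying these equations into
  a block diagonal one, whose coordinates are the products of those of its blocks. This gives the
  isomorphism with the product in one direction; in the other, the coordinates of the \<open>i\<close>-th
  block are recovered, up to a common factor, by varying only the part of \<open>J\<close> in block \<open>i\<close>.
\<close>

section \<open>Morphisms given locally by multihomogeneous forms\<close>

text \<open>The intersections of a fixed subspace with the eigenspaces are never formed;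
  \<open>m\<close> is read off from Pluecker coordinates. If an operator with distinct eigenvalues
  stabilises the row span of \<open>B\<close>, so does every polynomial in it, in particular the one
  that acts by 2 on eigenspace \<open>i\<close> and by 1 on the others. It multiplies the coordinate
  at \<open>J\<close> by 2 to the number of elements of \<open>J\<close> in block \<open>i\<close>,
  and it multiplies all coordinates by one common determinant; hence these numbers agree for all
  \<open>J\<close> with nonzero coordinate. Any number whose powers are distinct would do in place
  of 2. The same comparison of column and row scalings makes the coordinates of a block diagonal
  matrix vanish off type. The obstacle on the side of varieties is that the inverse of the product
  map has no single formula: it depends on a set \<open>J\<close> whose coordinate is nonzero, and
  \<open>J\<close> varies with the point. Morphisms are therefore recognised locally, by tuples of
  forms. A change of basis acts linearly on Pluecker coordinates, so equations in the eigenbasis are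
  forms in the original coordinates.\<close>

lemma multiform_scale:
  assumes "multiform d f"
  shows "multiform d (\<lambda>z. c * f z)"
  using multiform.mult[OF multiform.const[of c] assms] by simp

text \<open>The empty sum requires a zero form of degree \<open>d\<close>. It is obtained as 0 times
  some form of that degree; a degree of infinite support has none.\<close>

lemma multiform_sum:
  fixes f :: "'s \<Rightarrow> (nat \<Rightarrow> 'v \<Rightarrow> complex) \<Rightarrow> complex"
  assumes "finite S" "multiform d (\<lambda>z :: nat \<Rightarrow> 'v \<Rightarrow> complex. 0)" "\<And>s. s \<in> S \<Longrightarrow> multiform d (f s)"
  shows "multiform d (\<lambda>z. \<Sum>s\<in>S. f s z)"
  using assms
proof (induction S rule: finite_induct)
  case (insert s S)
  then show ?case by (simp add: multiform.add)
qed simp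

lemma multiform_prod:
  assumes "finite S" "\<And>s. s \<in> S \<Longrightarrow> multiform (d s) (f s)"
  shows "multiform (\<lambda>i. \<Sum>s\<in>S. d s i) (\<lambda>z. \<Prod>s\<in>S. f s z)"
  using assms
proof (induction S rule: finite_induct)
  case (insert s S)
  then show ?case by (simp add: multiform.mult)
qed (simp add: multiform.const)

text \<open>The value is multiplied by the product of the \<open>c i ^ d i\<close>, which makes
  sense because only finitely many \<open>d i\<close> are nonzero.\<close>

lemma multiform_rescale:
  assumes "multiform d f" and "\<And>i. c i \<noteq> 0"
  shows "f (\<lambda>i v. c i * z i v) \<noteq> 0 \<longleftrightarrow> f z \<noteq> 0"
proof -
  have fin: "finite {i. d i \<noteq> 0}" if "multiform d f" for d and f :: "(nat \<Rightarrow> 'a \<Rightarrow> complex) \<Rightarrow> complex"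
    using that
  proof induction
    case (mult d f e g)
    have "{i. d i + e i \<noteq> 0} = {i. d i \<noteq> 0} \<union> {i. e i \<noteq> 0}" by auto
    then show ?case using mult.IH by simp
  qed (auto simp: if_distrib[of "\<lambda>x. x \<noteq> 0"])
  have "f (\<lambda>i v. c i * z i v) = (\<Prod>i | d i \<noteq> 0. c i ^ d i) * f z"
    using assms(1)
  proof induction
    case (coord i v)
    have "{j. ((\<lambda>_. 0)(i := 1::nat)) j \<noteq> 0} = {i}" by auto
    then show ?case by simp
  next
    case (mult d f e g)
    let ?D = "{i. d i \<noteq> 0}" and ?E = "{i. e i \<noteq> 0}"
    have "finite ?D" "finite ?E" using fin mult.hyps by blast+
    moreover have "{i. d i + e i \<noteq> 0} = ?D \<union> ?E" by auto
    moreover have "(\<Prod>i\<in>?D \<union> ?E. c i ^ d i) = (\<Prod>i\<in>?D. c i ^ d i)"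
      using calculation by (intro prod.mono_neutral_right) auto
    moreover have "(\<Prod>i\<in>?D \<union> ?E. c i ^ e i) = (\<Prod>i\<in>?E. c i ^ e i)"
      using calculation by (intro prod.mono_neutral_right) auto
    ultimately show ?case using mult.IH by (simp add: power_add prod.distrib)
  qed (simp_all add: algebra_simps)
  moreover have "(\<Prod>i | d i \<noteq> 0. c i ^ d i) \<noteq> 0"
    using fin[OF assms(1)] assms(2) by simp
  ultimately show ?thesis by simp
qed

text \<open>A form may mention blocks beyond the factors that occur, so \<open>d i\<close> is
  arbitrary for \<open>i \<ge> N\<close>. As those blocks are substituted by forms of degree 0, the
  sum over \<open>i < N\<close> gives the right degree for every \<open>d\<close>.\<close>

lemma multiform_compose:
  assumes "multiform d f"
    and F: "\<And>i v. multiform (D i) (\<lambda>z. F z i v)"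
    and D: "\<And>i. N \<le> i \<Longrightarrow> D i = (\<lambda>_. 0)"
  shows "multiform (\<lambda>j. \<Sum>i<N. d i * D i j) (\<lambda>z. f (F z))"
  using assms(1)
proof induction
  case (coord i v)
  have "(\<Sum>i'<N. ((\<lambda>_. 0)(i := 1)) i' * D i' j) = D i j" for j
  proof (cases "i < N")
    case True
    have "(\<Sum>i'<N. ((\<lambda>_. 0)(i := 1)) i' * D i' j) = (\<Sum>i'<N. if i' = i then D i' j else 0)"
      by (intro sum.cong) auto
    then show ?thesis using True by simp
  next
    case False
    then show ?thesis using D by simp
  qed
  then show ?case using F[of i v] by simp
qed (simp_all add: multiform.const multiform.add multiform.mult sum.distrib algebra_simps)

section \<open>Coordinates of points in products of projective spaces\<close>

definition proj_lists :: "'v proj list set \<Rightarrow> bool" where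
  "proj_lists V \<longleftrightarrow> (\<forall>x\<in>V. \<forall>P\<in>set x. \<exists>z. P = proj_pt z)"

lemma proj_lists_subset: "proj_lists V \<Longrightarrow> U \<subseteq> V \<Longrightarrow> proj_lists U"
  unfolding proj_lists_def by blast

lemma proj_pt_self: "z \<in> proj_pt z"
  unfolding proj_pt_def by (auto intro!: exI[of _ 1])

lemma proj_pt_scale:
  assumes "c \<noteq> 0"
  shows "proj_pt (\<lambda>v. c * z v) = proj_pt z"
proof -
  have "(\<lambda>v. a * z v) \<in> proj_pt (\<lambda>v. c * z v)" if "a \<noteq> 0" for a
    unfolding proj_pt_def using assms that by (auto intro!: exI[of _ "a / c"])
  moreover have "(\<lambda>v. a * (c * z v)) \<in> proj_pt z" if "a \<noteq> 0" for a
    unfolding proj_pt_def using assms that by (auto intro!: exI[of _ "a * c"])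
  ultimately show ?thesis unfolding proj_pt_def by blast
qed

lemma proj_pt_eqI: "w \<in> proj_pt u \<Longrightarrow> proj_pt w = proj_pt u"
  using proj_pt_scale unfolding proj_pt_def by fastforce

lemma hcoords_nonempty:
  assumes "proj_lists V" "x \<in> V"
  obtains z where "z \<in> hcoords x"
proof -
  have "\<exists>w. w \<in> x ! i" if "i < length x" for i
    using assms that proj_pt_self unfolding proj_lists_def by (metis nth_mem)
  then obtain w where "\<And>i. i < length x \<Longrightarrow> w i \<in> x ! i" by metis
  then have "(\<lambda>i. if i < length x then w i else (\<lambda>_. 0)) \<in> hcoords x"
    unfolding hcoords_def by simp
  then show thesis by (rule that)
qed

text \<open>Two systems of coordinates of \<open>x\<close> differ by a nonzero factor in each block;
  beyond the length of \<open>x\<close> both are 0 and the factor is 1.\<close>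

lemma hcoords_nonzero_iff:
  assumes V: "proj_lists V" "x \<in> V" and z: "z \<in> hcoords x" "w \<in> hcoords x"
    and f: "multiform d f"
  shows "f z \<noteq> 0 \<longleftrightarrow> f w \<noteq> 0"
proof -
  have "\<exists>c. c \<noteq> 0 \<and> z i = (\<lambda>v. c * w i v)" for i
  proof (cases "i < length x")
    case True
    then obtain u where u: "x ! i = proj_pt u" using V unfolding proj_lists_def by (meson nth_mem)
    have "z i \<in> x ! i" "w i \<in> x ! i" using z True unfolding hcoords_def by auto
    then obtain a b where "a \<noteq> 0" "b \<noteq> 0" "z i = (\<lambda>v. a * u v)" "w i = (\<lambda>v. b * u v)"
      unfolding u proj_pt_def by blast
    then show ?thesis by (intro exI[of _ "a / b"]) auto
  next
    case False
    then show ?thesis using z unfolding hcoords_def by (intro exI[of _ 1]) simp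
  qed
  then obtain c where c: "\<And>i. c i \<noteq> 0" "\<And>i. z i = (\<lambda>v. c i * w i v)" by metis
  have "z = (\<lambda>i v. c i * w i v)" using c(2) by blast
  then show ?thesis using multiform_rescale[OF f c(1)] by simp
qed

lemma openin_zariski_form:
  assumes "multiform d f"
  shows "openin (zariski V) {x \<in> V. \<forall>z\<in>hcoords x. f z \<noteq> 0}"
  unfolding openin_zariski using assms by (intro exI[of _ "{f}"]) auto

text \<open>All coordinates of factor \<open>i\<close> share the degree \<open>D i\<close>, as they
  must to define a point of a projective space. Absence of common zeros is contained in
  \<open>F z \<in> hcoords (\<phi> y)\<close>, since the points that occur below are orbits of
  nonzero vectors.\<close>

definition forms_near ::
  "nat \<Rightarrow> 'v proj list set \<Rightarrow> ('v proj list \<Rightarrow> 'w proj list) \<Rightarrow> 'v proj list \<Rightarrow> bool" where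
  "forms_near N V \<phi> x \<longleftrightarrow> (\<exists>U D F. openin (zariski V) U \<and> x \<in> U \<and>
     (\<forall>i v. multiform (D i) (\<lambda>z. F z i v)) \<and> (\<forall>i\<ge>N. D i = (\<lambda>_. 0)) \<and>
     (\<forall>y\<in>U. \<forall>z\<in>hcoords y. F z \<in> hcoords (\<phi> y)))"

text \<open>The degree of a pulled-back form depends only on the degree of the form, so that quotients of
  forms of equal degree are pulled back to such quotients.\<close>

lemma forms_near_pullback:
  assumes "forms_near N V \<phi> x"
  shows "\<exists>U e T. openin (zariski V) U \<and> x \<in> U \<and>
      (\<forall>d f. multiform d f \<longrightarrow> multiform (e d) (T f)) \<and>
      (\<forall>y\<in>U. \<forall>z\<in>hcoords y. \<exists>w\<in>hcoords (\<phi> y). \<forall>f. T f z = f w)"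
proof -
  obtain U D F where U: "openin (zariski V) U" "x \<in> U"
    and F: "\<And>i v. multiform (D i) (\<lambda>z. F z i v)" and D: "\<And>i. i \<ge> N \<Longrightarrow> D i = (\<lambda>_. 0)"
    and FU: "\<And>y z. y \<in> U \<Longrightarrow> z \<in> hcoords y \<Longrightarrow> F z \<in> hcoords (\<phi> y)"
    using assms unfolding forms_near_def by metis
  have "multiform (\<lambda>j. \<Sum>i<N. d i * D i j) (\<lambda>z. f (F z))" if "multiform d f" for d f
    using multiform_compose[OF that F D] .
  then show ?thesis
    by (intro exI[of _ U] exI[of _ "\<lambda>d j. \<Sum>i<N. d i * D i j"] exI[of _ "\<lambda>f z. f (F z)"])
      (intro conjI ballI allI impI; (rule U | blast intro: FU))
qed

text \<open>Near \<open>x\<close>, a form that does not vanish at \<open>\<phi> x\<close> pulls back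
  to one that does not vanish at \<open>x\<close>, which gives continuity. A quotient of forms of
  equal degree pulls back to such a quotient, which gives regularity.\<close>

lemma variety_morphism_local:
  assumes V: "proj_lists V" and W: "proj_lists W" and maps: "\<And>x. x \<in> V \<Longrightarrow> \<phi> x \<in> W"
    and near: "\<And>x. x \<in> V \<Longrightarrow> forms_near N V \<phi> x"
  shows "variety_morphism V W \<phi>"
proof -
  let ?pre = "\<lambda>U. {x \<in> V. \<phi> x \<in> U}"
  have pullback: "\<exists>U e T. openin (zariski V) U \<and> x \<in> U \<and>
      (\<forall>d f. multiform d f \<longrightarrow> multiform (e d) (T f)) \<and>
      (\<forall>y\<in>U. \<forall>z\<in>hcoords y. \<exists>w\<in>hcoords (\<phi> y). \<forall>f. T f z = f w)" if "x \<in> V" for x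
    using forms_near_pullback[OF near[OF that]] .
  have open_pre: "openin (zariski V) (?pre O')" if O': "openin (zariski W) O'" for O'
  proof (subst openin_subopen, intro ballI)
    fix x assume x: "x \<in> ?pre O'"
    obtain G where G: "\<And>f. f \<in> G \<Longrightarrow> \<exists>d. multiform d f"
      and O'_eq: "O' = {y \<in> W. \<exists>f\<in>G. \<forall>w\<in>hcoords y. f w \<noteq> 0}"
      using O' unfolding openin_zariski by blast
    obtain f where f: "f \<in> G" "\<forall>w\<in>hcoords (\<phi> x). f w \<noteq> 0" using x O'_eq by blast
    obtain d where d: "multiform d f" using G f(1) by blast
    have "x \<in> V" using x by blast
    from pullback[OF this] obtain U e T where U: "openin (zariski V) U" "x \<in> U"
      and T: "\<forall>d f. multiform d f \<longrightarrow> multiform (e d) (T f)"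
      and TU: "\<forall>y\<in>U. \<forall>z\<in>hcoords y. \<exists>w\<in>hcoords (\<phi> y). \<forall>f. T f z = f w"
      by (elim exE conjE) (rule that)
    let ?U = "U \<inter> {y \<in> V. \<forall>z\<in>hcoords y. T f z \<noteq> 0}"
    have "openin (zariski V) ?U"
      using U(1) openin_zariski_form T d by (blast intro: openin_Int)
    moreover have "x \<in> ?U" using U(2) x TU f(2) by fastforce
    moreover have "?U \<subseteq> ?pre O'"
    proof
      fix y assume y: "y \<in> ?U"
      then have "y \<in> V" by blast
      then obtain z where z: "z \<in> hcoords y" using hcoords_nonempty[OF V] by blast
      obtain w where w: "w \<in> hcoords (\<phi> y)" "T f z = f w" using TU y z by blast
      have "f w \<noteq> 0" using y z w(2) by auto
      \<comment> \<open>The pullback speaks only of the one system \<open>w\<close>; homogeneity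
        extends the conclusion to all coordinates of \<open>\<phi> y\<close>.\<close>
      then have "\<forall>w\<in>hcoords (\<phi> y). f w \<noteq> 0"
        using hcoords_nonzero_iff[OF W maps[OF \<open>y \<in> V\<close>] w(1) _ d] by blast
      then show "y \<in> ?pre O'" using \<open>y \<in> V\<close> maps f(1) unfolding O'_eq by blast
    qed
    ultimately show "\<exists>T. openin (zariski V) T \<and> x \<in> T \<and> T \<subseteq> ?pre O'" by blast
  qed
  have "continuous_map (zariski V) (zariski W) \<phi>"
    unfolding continuous_map_def using open_pre maps by auto
  moreover have "regular_on V (?pre O') (h \<circ> \<phi>)" if reg: "regular_on W O' h" for O' h
    unfolding regular_on_def
  proof (intro conjI ballI)
    show "openin (zariski V) (?pre O')" using reg open_pre unfolding regular_on_def by blast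
    fix x assume x: "x \<in> ?pre O'"
    obtain O'' d f g where O'': "openin (zariski W) O''" "\<phi> x \<in> O''" "O'' \<subseteq> O'"
      and fg: "multiform d f" "multiform d g"
      and h: "\<forall>y\<in>O''. \<forall>z\<in>hcoords y. g z \<noteq> 0 \<and> h y = f z / g z"
      using reg x unfolding regular_on_def by blast
    have "x \<in> V" using x by blast
    from pullback[OF this] obtain U e T where U: "openin (zariski V) U" "x \<in> U"
      and T: "\<forall>d f. multiform d f \<longrightarrow> multiform (e d) (T f)"
      and TU: "\<forall>y\<in>U. \<forall>z\<in>hcoords y. \<exists>w\<in>hcoords (\<phi> y). \<forall>f. T f z = f w"
      by (elim exE conjE) (rule that)
    have "openin (zariski V) (U \<inter> ?pre O'')" "x \<in> U \<inter> ?pre O''" "U \<inter> ?pre O'' \<subseteq> ?pre O'"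
      using U open_pre[OF O''(1)] x O'' by auto
    moreover have "multiform (e d) (T f)" "multiform (e d) (T g)" using T fg by blast+
    moreover have "\<forall>y\<in>U \<inter> ?pre O''. \<forall>z\<in>hcoords y. T g z \<noteq> 0 \<and> (h \<circ> \<phi>) y = T f z / T g z"
    proof (intro ballI)
      fix y z assume y: "y \<in> U \<inter> ?pre O''" and z: "z \<in> hcoords y"
      obtain w where w: "w \<in> hcoords (\<phi> y)" "\<forall>f. T f z = f w" using TU y z by blast
      then show "T g z \<noteq> 0 \<and> (h \<circ> \<phi>) y = T f z / T g z" using h y by auto
    qed
    ultimately show "\<exists>U' d f g. openin (zariski V) U' \<and> x \<in> U' \<and> U' \<subseteq> ?pre O' \<and>
        multiform d f \<and> multiform d g \<and>
        (\<forall>y\<in>U'. \<forall>z\<in>hcoords y. g z \<noteq> 0 \<and> (h \<circ> \<phi>) y = f z / g z)" by blast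
  qed
  ultimately show ?thesis unfolding variety_morphism_def by blast
qed

lemma mem_listset_iff:
  "xs \<in> listset As \<longleftrightarrow> length xs = length As \<and> (\<forall>i<length As. xs ! i \<in> As ! i)"
proof (induction As arbitrary: xs)
  case (Cons A As)
  show ?case
    by (cases xs) (auto simp: set_Cons_def Cons.IH All_less_Suc2)
qed auto

lemma listset_singleton: "listset [S] = (\<lambda>x. [x]) ` S"
  by (auto simp: set_Cons_def)

lemma hcoords_singleton: "z \<in> hcoords [x] \<longleftrightarrow> z 0 \<in> x \<and> (\<forall>i\<ge>1. z i = (\<lambda>_. 0))"
  by (auto simp: hcoords_def)

section \<open>Maximal minors\<close>

lemma bij_betw_pick:
  assumes "finite I"
  shows "bij_betw (pick I) {..<card I} I"
proof -
  have inj: "inj_on (pick I) {..<card I}"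
    by (intro linorder_inj_onI') (metis lessThan_iff nat_neq_iff pick_mono_le)
  moreover have "pick I ` {..<card I} \<subseteq> I" using pick_in_set_le by auto
  ultimately show ?thesis
    using assms card_subset_eq[of I "pick I ` {..<card I}"] by (simp add: bij_betw_def card_image)
qed

text \<open>\<open>pick I s\<close> is characterised as the element of \<open>I\<close> with exactly
  \<open>s\<close> elements of \<open>I\<close> below it.\<close>

lemma pick_unique:
  assumes g: "\<And>s t. s < t \<Longrightarrow> t < k \<Longrightarrow> g s < g t" and I: "g ` {..<k} = I" and s: "s < k"
  shows "pick I s = g s"
proof -
  have mono: "g t < g s \<longleftrightarrow> t < s" if "t < k" for t
    using g[of t s] g[of s t] that s by (cases t s rule: linorder_cases) auto
  have inj: "inj_on g {..<s}"
    using g s by (intro linorder_inj_onI') (metis lessThan_iff nat_neq_iff order.strict_trans)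
  have "{a \<in> I. a < g s} = g ` {..<s}"
    using mono s unfolding I[symmetric] by fastforce
  then have "card {a \<in> I. a < g s} = s" using card_image[OF inj] by simp
  then show ?thesis using pick_card_in_set[of "g s" I] I s by auto
qed

lemma permutes_upt_less: "\<pi> permutes {0..<k} \<Longrightarrow> s < k \<Longrightarrow> \<pi> s < (k :: nat)"
  using permutes_in_image[of \<pi> "{0..<k}" s] by simp

text \<open>The columns may come in any order and with repetitions, since expanding a product of
  matrices or exchanging a column leads out of the increasing enumerations.\<close>

definition col_minor :: "complex mat \<Rightarrow> (nat \<Rightarrow> nat) \<Rightarrow> complex" where
  "col_minor A f = det (mat (dim_row A) (dim_row A) (\<lambda>(r, s). A $$ (r, f s)))"

lemma submatrix_cols:
  assumes A: "A \<in> carrier_mat k n" and I: "I \<subseteq> {..<n}" "card I = k"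
  shows "submatrix A UNIV I = mat k k (\<lambda>(r, s). A $$ (r, pick I s))"
proof -
  have "{j. j < n \<and> j \<in> I} = I" using I by auto
  then show ?thesis using A I by (intro eq_matI) (auto simp: submatrix_def pick_UNIV)
qed

lemma plucker_coord_eq_col_minor:
  assumes A: "A \<in> carrier_mat k n" and I: "I \<subseteq> {..<n}" "card I = k"
  shows "plucker_coord A I = col_minor A (pick I)"
  using assms by (simp add: plucker_coord_def col_minor_def submatrix_cols)

lemma col_minor_Leibniz:
  assumes A: "A \<in> carrier_mat k n"
  shows "col_minor A f =
    (\<Sum>\<pi> | \<pi> permutes {0..<k}. signof \<pi> * (\<Prod>s<k. A $$ (\<pi> s, f s)))"
proof -
  have "\<pi> s < k" if "\<pi> permutes {0..<k}" "s < k" for \<pi> s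
    using that by (simp add: permutes_upt_less)
  then show ?thesis using A
    by (auto simp: col_minor_def det_col[of _ k] intro!: sum.cong prod.cong)
qed

text \<open>The factor is the sign of the permutation sorting \<open>f\<close>, or 0 when \<open>f\<close> repeats a column.\<close>

lemma col_minor_eq_plucker_coord:
  assumes f: "f \<in> {..<k} \<rightarrow> {..<n}"
  shows "\<exists>c. \<forall>A\<in>carrier_mat k n. col_minor A f = c * plucker_coord A (f ` {..<k})"
proof (cases "inj_on f {..<k}")
  case False
  then obtain s t where st: "s < k" "t < k" "s \<noteq> t" "f s = f t" unfolding inj_on_def by auto
  have "col_minor A f = 0" if A: "A \<in> carrier_mat k n" for A
    unfolding col_minor_def using A st
    by (intro det_identical_columns[of _ k s t]) (auto intro!: eq_vecI)
  then show ?thesis by (intro exI[of _ 0]) simp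
next
  case True
  let ?I = "f ` {..<k}"
  have cI: "card ?I = k" using True card_image by force
  have I: "?I \<subseteq> {..<n}" using f by auto
  have bij: "bij_betw (pick ?I) {..<k} ?I" using bij_betw_pick[of ?I] cI by simp
  define \<pi> where "\<pi> s = (if s < k then inv_into {..<k} (pick ?I) (f s) else s)" for s
  have pick_\<pi>: "pick ?I (\<pi> s) = f s" if "s < k" for s
    using that bij by (simp add: \<pi>_def bij_betw_inv_into_right)
  have "bij_betw (inv_into {..<k} (pick ?I) \<circ> f) {..<k} {..<k}"
    using True bij by (intro bij_betw_trans[OF _ bij_betw_inv_into]) (auto simp: bij_betw_def)
  then have "bij_betw \<pi> {..<k} {..<k}" by (rule bij_betw_cong[THEN iffD1, rotated]) (simp add: \<pi>_def)
  then have \<pi>: "\<pi> permutes {0..<k}"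
    by (intro bij_imp_permutes) (auto simp: \<pi>_def atLeast0LessThan)
  have "col_minor A f = signof \<pi> * plucker_coord A ?I" if A: "A \<in> carrier_mat k n" for A
  proof -
    let ?S = "mat k k (\<lambda>(r, s). A $$ (r, pick ?I s))"
    have "col_minor A f = det (mat k k (\<lambda>(r, s). A $$ (s, f r)))"
      using A by (subst det_transpose[symmetric, of _ k])
        (auto simp: col_minor_def intro!: arg_cong[of _ _ det] eq_matI)
    also have "mat k k (\<lambda>(r, s). A $$ (s, f r)) = mat k k (\<lambda>(r, s). transpose_mat ?S $$ (\<pi> r, s))"
      using permutes_upt_less[OF \<pi>] pick_\<pi> by (intro cong_mat) auto
    also have "det \<dots> = signof \<pi> * det (transpose_mat ?S)"
      by (rule det_permute_rows[OF _ \<pi>]) simp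
    also have "det (transpose_mat ?S) = plucker_coord A ?I"
      using A cI I by (subst det_transpose[of _ k]) (auto simp: plucker_coord_def submatrix_cols)
    finally show ?thesis .
  qed
  then show ?thesis by blast
qed

text \<open>Column \<open>g s\<close> of the product combines the columns of \<open>A\<close> with
  coefficients from column \<open>g s\<close> of \<open>M\<close>; multilinearity gives one term for
  each choice \<open>f\<close> of a column of \<open>A\<close> for every \<open>s\<close>.\<close>

lemma col_minor_mult:
  assumes A: "A \<in> carrier_mat k n" and M: "M \<in> carrier_mat n m" and g: "g \<in> {..<k} \<rightarrow> {..<m}"
  shows "col_minor (A * M) g =
    (\<Sum>f\<in>{..<k} \<rightarrow>\<^sub>E {..<n}. (\<Prod>s<k. M $$ (f s, g s)) * col_minor A f)"
proof -
  have AM: "A * M \<in> carrier_mat k m" using A M by simp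
  let ?P = "{\<pi>. \<pi> permutes {0..<k}}" and ?F = "{..<k} \<rightarrow>\<^sub>E {..<n}"
  have "col_minor (A * M) g =
      (\<Sum>\<pi>\<in>?P. signof \<pi> * (\<Prod>s<k. \<Sum>j<n. A $$ (\<pi> s, j) * M $$ (j, g s)))"
    unfolding col_minor_Leibniz[OF AM]
  proof (intro sum.cong prod.cong refl arg_cong2[of _ _ _ _ "(*)"])
    fix \<pi> s assume "\<pi> \<in> ?P" "s \<in> {..<k}"
    then have "\<pi> s < k" "g s < m" using g permutes_upt_less[of \<pi> k] by auto
    then show "(A * M) $$ (\<pi> s, g s) = (\<Sum>j<n. A $$ (\<pi> s, j) * M $$ (j, g s))"
      using A M by (simp add: scalar_prod_def atLeast0LessThan)
  qed
  also have "\<dots> = (\<Sum>\<pi>\<in>?P. \<Sum>f\<in>?F. signof \<pi> * (\<Prod>s<k. A $$ (\<pi> s, f s) * M $$ (f s, g s)))"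
    by (simp add: prod_sum_PiE sum_distrib_left)
  also have "\<dots> = (\<Sum>f\<in>?F. \<Sum>\<pi>\<in>?P. signof \<pi> * (\<Prod>s<k. A $$ (\<pi> s, f s) * M $$ (f s, g s)))"
    by (rule sum.swap)
  also have "\<dots> = (\<Sum>f\<in>?F. (\<Prod>s<k. M $$ (f s, g s)) * col_minor A f)"
    by (simp add: col_minor_Leibniz[OF A] sum_distrib_left prod.distrib algebra_simps)
  finally show ?thesis .
qed

section \<open>Pluecker coordinates under multiplication of matrices\<close>

definition ksubsets :: "nat \<Rightarrow> nat \<Rightarrow> nat set set" where
  "ksubsets k n = {I. I \<subseteq> {..<n} \<and> card I = k}"

lemma finite_ksubsets [simp]: "finite (ksubsets k n)"
  unfolding ksubsets_def by (rule finite_subset[of _ "Pow {..<n}"]) auto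

lemma plucker_coord_outside:
  "A \<in> carrier_mat k n \<Longrightarrow> I \<notin> ksubsets k n \<Longrightarrow> plucker_coord A I = 0"
  by (auto simp: plucker_coord_def ksubsets_def)

text \<open>A weak form of the Cauchy--Binet formula; the coefficients are the minors of \<open>M\<close>.\<close>

lemma plucker_coord_mult_right:
  assumes M: "M \<in> carrier_mat n m"
  shows "\<exists>C. \<forall>A\<in>carrier_mat k n. \<forall>J.
    plucker_coord (A * M) J = (\<Sum>I\<in>ksubsets k n. C J I * plucker_coord A I)"
proof -
  let ?F = "{..<k} \<rightarrow>\<^sub>E {..<n}"
  have "\<exists>c. \<forall>f\<in>?F. \<forall>A\<in>carrier_mat k n. col_minor A f = c f * plucker_coord A (f ` {..<k})"
    by (intro bchoice ballI col_minor_eq_plucker_coord) auto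
  then obtain c where c: "\<And>f A. f \<in> ?F \<Longrightarrow> A \<in> carrier_mat k n \<Longrightarrow>
      col_minor A f = c f * plucker_coord A (f ` {..<k})" by blast
  define C where "C J I = (if J \<in> ksubsets k m
      then \<Sum>f | f \<in> ?F \<and> f ` {..<k} = I. (\<Prod>s<k. M $$ (f s, pick J s)) * c f else 0)" for J I
  have "plucker_coord (A * M) J = (\<Sum>I\<in>ksubsets k n. C J I * plucker_coord A I)"
    if A: "A \<in> carrier_mat k n" for A J
  proof (cases "J \<in> ksubsets k m")
    case False
    then show ?thesis using A M by (simp add: C_def plucker_coord_outside[of _ k m])
  next
    case True
    have fin: "finite ?F" by (simp add: finite_PiE)
    have J: "J \<subseteq> {..<m}" "card J = k" using True by (auto simp: ksubsets_def)
    then have "finite J" by (simp add: finite_subset)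
    then have g: "pick J \<in> {..<k} \<rightarrow> {..<m}"
      using bij_betw_pick[of J] J by (auto simp: bij_betw_def)
    let ?t = "\<lambda>f. (\<Prod>s<k. M $$ (f s, pick J s)) * c f * plucker_coord A (f ` {..<k})"
    have "plucker_coord (A * M) J = (\<Sum>f\<in>?F. ?t f)"
      using A M J by (simp add: plucker_coord_eq_col_minor[of _ k m] col_minor_mult[OF A M g] c
          mult.assoc)
    \<comment> \<open>The choices \<open>f\<close> are grouped by image. Images with fewer than
      \<open>k\<close> elements occur too; their coordinate is 0, so that they drop out
      below.\<close>
    also have "\<dots> = (\<Sum>I\<in>Pow {..<n}. \<Sum>f | f \<in> ?F \<and> f ` {..<k} = I. ?t f)"
      by (rule sum.group[OF fin, symmetric]) auto
    also have "\<dots> = (\<Sum>I\<in>Pow {..<n}. C J I * plucker_coord A I)"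
      using True by (auto simp: C_def sum_distrib_right intro!: sum.cong)
    also have "\<dots> = (\<Sum>I\<in>ksubsets k n. C J I * plucker_coord A I)"
      using plucker_coord_outside[OF A]
      by (intro sum.mono_neutral_right) (auto simp: ksubsets_def)
    finally show ?thesis .
  qed
  then show ?thesis by blast
qed

lemma plucker_coord_mult_left:
  assumes G: "G \<in> carrier_mat k k" and A: "A \<in> carrier_mat k n"
  shows "plucker_coord (G * A) I = det G * plucker_coord A I"
proof (cases "I \<in> ksubsets k n")
  case False
  then show ?thesis using plucker_coord_outside[of _ k n] G A by simp
next
  case True
  then have I: "I \<subseteq> {..<n}" "card I = k" by (auto simp: ksubsets_def)
  then have pick: "pick I s < n" if "s < k" for s using that pick_in_set_le[of s I] by auto
  have GA: "G * A \<in> carrier_mat k n" using G A by simp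
  let ?S = "mat k k (\<lambda>(r, s). A $$ (r, pick I s))"
  have "mat k k (\<lambda>(r, s). (G * A) $$ (r, pick I s)) = G * ?S"
    using G A pick by (intro eq_matI) (auto simp: scalar_prod_def)
  moreover have "det (G * ?S) = det G * det ?S" using G by (intro det_mult) auto
  moreover have "plucker_coord (G * A) I = det (submatrix (G * A) UNIV I)"
    "plucker_coord A I = det (submatrix A UNIV I)"
    using G A I by (simp_all add: plucker_coord_def)
  ultimately show ?thesis unfolding submatrix_cols[OF A I] submatrix_cols[OF GA I] by simp
qed

definition scale_cols :: "(nat \<Rightarrow> complex) \<Rightarrow> complex mat \<Rightarrow> complex mat" where
  "scale_cols d A = mat (dim_row A) (dim_col A) (\<lambda>(r, c). A $$ (r, c) * d c)"

lemma scale_cols_carrier [simp]: "A \<in> carrier_mat k n \<Longrightarrow> scale_cols d A \<in> carrier_mat k n"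
  by (simp add: scale_cols_def)

text \<open>Every term of the Leibniz expansion takes one entry from each column in
  \<open>J\<close>, hence the common factor.\<close>

lemma plucker_coord_scale_cols:
  assumes A: "A \<in> carrier_mat k n"
  shows "plucker_coord (scale_cols d A) J = (\<Prod>j\<in>J. d j) * plucker_coord A J"
proof (cases "J \<in> ksubsets k n")
  case False
  then show ?thesis using plucker_coord_outside[of _ k n] A by simp
next
  case True
  then have J: "J \<subseteq> {..<n}" "card J = k" by (auto simp: ksubsets_def)
  then have pick: "pick J s < n" if "s < k" for s using that pick_in_set_le[of s J] by auto
  have "finite J" using J by (simp add: finite_subset)
  then have d: "(\<Prod>s<k. d (pick J s)) = (\<Prod>j\<in>J. d j)"
    using prod.reindex_bij_betw[OF bij_betw_pick[of J]] J by simp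
  have "(\<Prod>s<k. scale_cols d A $$ (\<pi> s, pick J s)) =
      (\<Prod>j\<in>J. d j) * (\<Prod>s<k. A $$ (\<pi> s, pick J s))" if "\<pi> permutes {0..<k}" for \<pi>
    unfolding d[symmetric] prod.distrib[symmetric]
    using A pick permutes_upt_less[OF that] by (intro prod.cong) (auto simp: scale_cols_def)
  then show ?thesis
    using A J by (auto simp: plucker_coord_eq_col_minor[of _ k n] col_minor_Leibniz[of _ k n]
        sum_distrib_left algebra_simps intro!: sum.cong)
qed

section \<open>Row spans of full rank matrices\<close>

lemma mult_mat_unit_vec:
  fixes B :: "'a :: semiring_1 mat"
  assumes "B \<in> carrier_mat n k" "i < k"
  shows "B *\<^sub>v unit_vec k i = col B i"
  using assms by (intro eq_vecI) auto

lemma mult_eq_imp_row_span_subset: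
  assumes G: "G \<in> carrier_mat k k" and A: "A \<in> carrier_mat k n"
  shows "row_span n (G * A) \<subseteq> row_span n A"
proof -
  have GA: "G * A \<in> carrier_mat k n" using G A by simp
  have "transpose_mat (G * A) *\<^sub>v y = transpose_mat A *\<^sub>v (transpose_mat G *\<^sub>v y)"
    if "y \<in> carrier_vec k" for y
    using G A that by (simp add: transpose_mult[of _ k k _ n] assoc_mult_mat_vec[of _ n k _ k])
  moreover have "transpose_mat G *\<^sub>v y \<in> carrier_vec k" if "y \<in> carrier_vec k" for y
    using G that by simp
  ultimately show ?thesis
    unfolding row_span_eq[OF A] row_span_eq[OF GA] by blast
qed

lemma row_span_subset_imp_mult:
  assumes A: "A \<in> carrier_mat k n" and B: "B \<in> carrier_mat k n"
    and sub: "row_span n B \<subseteq> row_span n A"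
  obtains G where "G \<in> carrier_mat k k" "B = G * A"
proof -
  have "\<exists>y\<in>carrier_vec k. row B r = transpose_mat A *\<^sub>v y" if r: "r < k" for r
  proof -
    have "row B r = transpose_mat B *\<^sub>v unit_vec k r"
      using B r by (simp add: mult_mat_unit_vec[of _ n k])
    then have "row B r \<in> row_span n B" unfolding row_span_eq[OF B] by auto
    then show ?thesis using sub unfolding row_span_eq[OF A] by blast
  qed
  then obtain y where y: "\<And>r. r < k \<Longrightarrow> y r \<in> carrier_vec k"
    "\<And>r. r < k \<Longrightarrow> row B r = transpose_mat A *\<^sub>v y r" by metis
  define G where "G = mat k k (\<lambda>(r, s). y r $ s)"
  have G: "G \<in> carrier_mat k k" by (simp add: G_def)
  have "B = G * A"
  proof (rule eq_matI)
    fix r c assume "r < dim_row (G * A)" "c < dim_col (G * A)"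
    then have rc: "r < k" "c < n" using G A by auto
    have "B $$ (r, c) = row B r $ c" using B rc by simp
    also have "\<dots> = col A c \<bullet> y r" using y(2)[OF rc(1)] A rc by simp
    also have "\<dots> = (G * A) $$ (r, c)"
      using A y(1)[OF rc(1)] rc
      by (simp add: G_def scalar_prod_def) (auto intro!: sum.cong)
    finally show "B $$ (r, c) = (G * A) $$ (r, c)" .
  qed (use A B G in auto)
  then show thesis using that G by blast
qed

lemma row_span_mult_left:
  assumes G: "G \<in> carrier_mat k k" "det G \<noteq> 0" and A: "A \<in> carrier_mat k n"
  shows "row_span n (G * A) = row_span n A"
proof
  show "row_span n (G * A) \<subseteq> row_span n A" by (rule mult_eq_imp_row_span_subset[OF G(1) A])
  obtain H where H: "H \<in> carrier_mat k k" "H * G = 1\<^sub>m k"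
    using det_non_zero_imp_unit[OF G, of "()"] by (auto simp: Units_def ring_mat_def)
  have "A = H * (G * A)" using H G A by (simp flip: assoc_mult_mat[of H k k G k A n])
  then show "row_span n A \<subseteq> row_span n (G * A)"
    using mult_eq_imp_row_span_subset[OF H(1), of "G * A" n] G A by simp
qed

text \<open>A nonzero minor singles out \<open>k\<close> of the \<open>n\<close> equations
  \<open>transpose_mat A *\<^sub>v y = 0\<^sub>v n\<close> that form an invertible system.\<close>

lemma plucker_coord_nonzero_imp_inj:
  assumes A: "A \<in> carrier_mat k n" and I: "plucker_coord A I \<noteq> 0"
    and y: "y \<in> carrier_vec k" "transpose_mat A *\<^sub>v y = 0\<^sub>v n"
  shows "y = 0\<^sub>v k"
proof (rule ccontr)
  assume y0: "y \<noteq> 0\<^sub>v k"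
  have J: "I \<subseteq> {..<n}" "card I = k"
    using I plucker_coord_outside[OF A, of I] by (auto simp: ksubsets_def)
  let ?S = "mat k k (\<lambda>(r, s). A $$ (r, pick I s))"
  have S: "?S \<in> carrier_mat k k" by simp
  have "transpose_mat ?S *\<^sub>v y = 0\<^sub>v k"
  proof (rule eq_vecI)
    fix s assume "s < dim_vec (0\<^sub>v k :: complex vec)"
    then have s: "s < k" by simp
    then have p: "pick I s < n" using J pick_in_set_le[of s I] by auto
    have "(transpose_mat ?S *\<^sub>v y) $ s = (transpose_mat A *\<^sub>v y) $ pick I s"
      using A s p y(1) by (auto simp: scalar_prod_def intro!: sum.cong)
    then show "(transpose_mat ?S *\<^sub>v y) $ s = 0\<^sub>v k $ s" using y(2) s p by simp
  qed simp
  then have "det (transpose_mat ?S) = 0"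
    using det_0_iff_vec_prod_zero_field[of "transpose_mat ?S" k] y(1) y0 S by auto
  then have "det ?S = 0" using det_transpose[OF S] by simp
  then show False using I J A by (simp add: plucker_coord_def submatrix_cols)
qed

text \<open>If all maximal minors of \<open>A\<close> vanish then so does the determinant of the Gram matrix
  \<open>A A\<^sup>*\<close>, and \<open>A A\<^sup>* y = 0\<close> forces \<open>A\<^sup>* y = 0\<close>.\<close>

lemma inj_imp_plucker_coord_nonzero:
  assumes A: "A \<in> carrier_mat k n"
    and inj: "\<And>y. y \<in> carrier_vec k \<Longrightarrow> transpose_mat A *\<^sub>v y = 0\<^sub>v n \<Longrightarrow> y = 0\<^sub>v k"
  shows "\<exists>I. plucker_coord A I \<noteq> 0"
proof (rule ccontr)
  assume "\<not> ?thesis"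
  then have zero: "plucker_coord A I = 0" for I by blast
  define M where "M = mat n k (\<lambda>(c, r). cnj (A $$ (r, c)))"
  have M: "M \<in> carrier_mat n k" by (simp add: M_def)
  have AM: "A * M \<in> carrier_mat k k" using A M by simp
  have "\<exists>C. \<forall>A\<in>carrier_mat k n. \<forall>J.
      plucker_coord (A * M) J = (\<Sum>I\<in>ksubsets k n. C J I * plucker_coord A I)"
    by (rule plucker_coord_mult_right[OF M])
  \<comment> \<open>\<open>A * M\<close> is square, so its determinant is its only maximal minor and
    thereby a combination of the minors of \<open>A\<close>.\<close>
  then have "plucker_coord (A * M) {..<k} = 0" using A zero by auto
  moreover have "submatrix (A * M) UNIV {..<k} = A * M"
  proof -
    have "pick {..<k} s = s" if "s < k" for s
      using pick_unique[of k "\<lambda>s. s" "{..<k}" s] that by simp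
    then show ?thesis unfolding submatrix_cols[OF AM subset_refl card_lessThan]
      using carrier_matD[OF AM] by (intro eq_matI) (simp_all del: index_mult_mat)
  qed
  ultimately have "det (A * M) = 0" using A M by (simp add: plucker_coord_def)
  then obtain v where v: "v \<in> carrier_vec k" "v \<noteq> 0\<^sub>v k" "(A * M) *\<^sub>v v = 0\<^sub>v k"
    using det_0_iff_vec_prod_zero_field[OF AM] by auto
  define w where "w = M *\<^sub>v v"
  have w: "w \<in> carrier_vec n" using M v by (simp add: w_def)
  have Aw: "A *\<^sub>v w = 0\<^sub>v k"
    using v(3) assoc_mult_mat_vec[OF A M v(1)] by (simp add: w_def)
  have row: "(\<Sum>c<n. A $$ (r, c) * w $ c) = 0" if r: "r < k" for r
  proof -
    have "(\<Sum>c<n. A $$ (r, c) * w $ c) = (A *\<^sub>v w) $ r"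
      using A w r by (auto simp: scalar_prod_def atLeast0LessThan intro!: sum.cong)
    then show ?thesis using Aw r by simp
  qed
  have w_eq: "w $ c = (\<Sum>r<k. cnj (A $$ (r, c)) * v $ r)" if "c < n" for c
    using that M v(1) by (auto simp: w_def M_def scalar_prod_def atLeast0LessThan intro!: sum.cong)
  \<comment> \<open>With \<open>M\<close> the adjoint of \<open>A\<close>, the squared norm of
    \<open>w = M v\<close> equals the inner product of \<open>A w = 0\<close> with
    \<open>v\<close>.\<close>
  have "(\<Sum>c<n. w $ c * cnj (w $ c)) = (\<Sum>c<n. \<Sum>r<k. cnj (v $ r) * (A $$ (r, c) * w $ c))"
  proof (intro sum.cong refl)
    fix c assume "c \<in> {..<n}"
    then have "cnj (w $ c) = (\<Sum>r<k. A $$ (r, c) * cnj (v $ r))" using w_eq by simp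
    then show "w $ c * cnj (w $ c) = (\<Sum>r<k. cnj (v $ r) * (A $$ (r, c) * w $ c))"
      by (simp add: sum_distrib_left algebra_simps)
  qed
  also have "\<dots> = (\<Sum>r<k. cnj (v $ r) * (\<Sum>c<n. A $$ (r, c) * w $ c))"
    by (subst sum.swap) (simp add: sum_distrib_left)
  finally have "(\<Sum>c<n. w $ c * cnj (w $ c)) = 0" using row by simp
  then have "(\<Sum>c<n. complex_of_real ((cmod (w $ c))\<^sup>2)) = 0"
    by (simp only: complex_norm_square)
  then have "(\<Sum>c<n. (cmod (w $ c))\<^sup>2) = 0"
    unfolding of_real_sum[symmetric] of_real_eq_0_iff .
  then have w0: "w $ c = 0" if "c < n" for c using that by (simp add: sum_nonneg_eq_0_iff)
  \<comment> \<open>Injectivity is assumed for the transpose and not for the adjoint: the conjugate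
    of \<open>w\<close> is \<open>transpose_mat A\<close> applied to the conjugate of
    \<open>v\<close>.\<close>
  define y where "y = vec k (\<lambda>r. cnj (v $ r))"
  have "transpose_mat A *\<^sub>v y = 0\<^sub>v n"
  proof (rule eq_vecI)
    fix c assume "c < dim_vec (0\<^sub>v n :: complex vec)"
    then have c: "c < n" by simp
    have "(transpose_mat A *\<^sub>v y) $ c = (\<Sum>r<k. A $$ (r, c) * cnj (v $ r))"
      using A c by (auto simp: y_def scalar_prod_def atLeast0LessThan intro!: sum.cong)
    also have "\<dots> = cnj (w $ c)" using c by (simp add: w_eq)
    finally show "(transpose_mat A *\<^sub>v y) $ c = 0\<^sub>v n $ c" using w0 c by simp
  qed (use A in simp)
  then have y0: "y = 0\<^sub>v k" using inj[of y] by (simp add: y_def)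
  have "v $ r = 0" if "r < k" for r
  proof -
    have "y $ r = 0" using y0 that by simp
    then show ?thesis using that by (simp add: y_def)
  qed
  then show False using v(1,2) by auto
qed

text \<open>A nonzero maximal minor is the matrix form of linear independence of the rows. This
  passes from the abstract dimension in \<open>Gr\<close> to matrices, with which all later
  arguments work.\<close>

lemma Gr_eq_row_spans:
  "Gr k n = {row_span n A | A. A \<in> carrier_mat k n \<and> (\<exists>I. plucker_coord A I \<noteq> 0)}"
proof -
  interpret vec_space "TYPE(complex)" n .
  show ?thesis
  proof (intro equalityI subsetI)
    fix W assume "W \<in> Gr k n"
    then have sub: "subspace class_ring W V" and dim: "vectorspace.dim class_ring (vs W) = k"
      by (auto simp: Gr_def)
    interpret W: vectorspace class_ring "vs W" using subspace_is_vs[OF sub] .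
    have WV: "W \<subseteq> carrier_vec n" and subm: "submodule class_ring W V"
      using sub by (auto simp: subspace_def submodule_def)
    \<comment> \<open>Independent subsets of \<open>W\<close> are bounded in size by the ambient
      dimension, which yields a maximal one without prior knowledge that \<open>W\<close> is finite
      dimensional.\<close>
    have bound: "finite S \<and> card S \<le> n" if "S \<subseteq> W \<and> lin_indpt S" for S
      using li_le_dim[OF fin_dim, of S] that WV dim_is_n by auto
    have "lin_indpt {}" by (simp add: lin_dep_def)
    then have "\<exists>S. finite S \<and> maximal S (\<lambda>S. S \<subseteq> W \<and> lin_indpt S)"
      by (intro maximal_exists[where N = n and B = "{}"] bound) simp_all
    then obtain S where S: "finite S" "maximal S (\<lambda>S. S \<subseteq> W \<and> lin_indpt S)" by blast
    have "S \<subseteq> W" "lin_indpt S" using S(2) by (auto simp: maximal_def)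
    have "maximal S (\<lambda>S. S \<subseteq> carrier (vs W) \<and> W.lin_indpt S)"
      using S(2) span_li_not_depend(2)[OF _ subm] by (simp add: maximal_def) blast
    then have basis: "W.basis S" by (rule W.max_li_is_basis)
    have card: "card S = k" using W.dim_basis[OF S(1) basis] dim by simp
    have span: "span S = W"
      using basis span_li_not_depend(1)[OF \<open>S \<subseteq> W\<close> subm] by (simp add: W.basis_def)
    obtain xs where xs: "set xs = S" "distinct xs"
      using finite_distinct_list[OF S(1)] by blast
    then have len: "length xs = k" using card distinct_card by force
    define A where "A = mat_of_rows n xs"
    have A: "A \<in> carrier_mat k n" using len by (auto simp: A_def)
    have rows: "rows A = xs" using xs(1) \<open>S \<subseteq> W\<close> WV by (auto simp: A_def)
    have "row_span n A = W" using rows xs span by (simp add: row_space_def)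
    moreover have "\<exists>I. plucker_coord A I \<noteq> 0"
    proof (rule inj_imp_plucker_coord_nonzero[OF A])
      fix y :: "complex vec" assume y: "y \<in> carrier_vec k" "transpose_mat A *\<^sub>v y = 0\<^sub>v n"
      show "y = 0\<^sub>v k"
        using lin_depI[of "transpose_mat A" k y] A y rows xs \<open>lin_indpt S\<close>
        by (auto simp: cols_transpose)
    qed
    ultimately show "W \<in> {row_span n A | A. A \<in> carrier_mat k n \<and> (\<exists>I. plucker_coord A I \<noteq> 0)}"
      using A by blast
  next
    fix W assume "W \<in> {row_span n A | A. A \<in> carrier_mat k n \<and> (\<exists>I. plucker_coord A I \<noteq> 0)}"
    then obtain A I where A: "A \<in> carrier_mat k n" "plucker_coord A I \<noteq> 0"
      and W: "W = row_span n A" by blast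
    let ?B = "transpose_mat A"
    have B: "?B \<in> carrier_mat n k" using A(1) by simp
    have rowsV: "set (rows A) \<subseteq> carrier_vec n" using A(1) by (auto simp: rows_def)
    have inj: "y = 0\<^sub>v k" if "y \<in> carrier_vec k" "?B *\<^sub>v y = 0\<^sub>v n" for y
      using plucker_coord_nonzero_imp_inj[OF A that] .
    \<comment> \<open>\<open>lin_indpt\<close> concerns the set of columns and does not see
      repetitions; equal columns \<open>i\<close> and \<open>j\<close> would put a difference of
      unit vectors into the kernel.\<close>
    have dist: "distinct (cols ?B)"
    proof (rule ccontr)
      assume "\<not> distinct (cols ?B)"
      then obtain i j where ij: "i < k" "j < k" "i \<noteq> j" "cols ?B ! i = cols ?B ! j"
        using B by (auto simp: distinct_conv_nth)
      then have cij: "col ?B i = col ?B j" using B by simp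
      let ?y = "unit_vec k i - unit_vec k j :: complex vec"
      have "?B *\<^sub>v ?y = col ?B i - col ?B j"
        using B ij by (simp add: mult_minus_distrib_mat_vec[OF B] mult_mat_unit_vec[OF B])
      then have "?B *\<^sub>v ?y = 0\<^sub>v n" using cij B by auto
      then have "?y = 0\<^sub>v k" by (intro inj) auto
      then have "?y $ i = 0" using ij by simp
      then show False using ij by simp
    qed
    have "lin_indpt (set (cols ?B))"
      using lin_depE[OF B _ dist] inj by metis
    then have "rank ?B = k" by (rule lin_indpt_full_rank[OF B dist])
    then have "vectorspace.dim class_ring (vs W) = k"
      by (simp add: rank_def W row_space_def cols_transpose)
    moreover have "subspace class_ring W V"
      unfolding W row_space_def by (rule span_is_subspace) (use rowsV in simp)
    ultimately show "W \<in> Gr k n" by (simp add: Gr_def)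
  qed
qed

lemma Gr_obtain:
  assumes "W \<in> Gr k n"
  obtains A where "A \<in> carrier_mat k n" "row_span n A = W" "\<exists>I. plucker_coord A I \<noteq> 0"
  using assms unfolding Gr_eq_row_spans by blast

lemma Gr_I: "A \<in> carrier_mat k n \<Longrightarrow> plucker_coord A I \<noteq> 0 \<Longrightarrow> row_span n A \<in> Gr k n"
  unfolding Gr_eq_row_spans by blast

text \<open>Matrices with the same row span differ by a left factor, hence their coordinates by its
  determinant. The coordinates of a full rank matrix \<open>A0\<close> of \<open>W\<close> are
  multiples of those of any other matrix of \<open>W\<close>, so none of these vanishes identically
  and the factors are nonzero.\<close>

lemma plucker_row_span:
  assumes A: "A \<in> carrier_mat k n" and W: "row_span n A = W" "W \<in> Gr k n"
  shows "plucker k n W = proj_pt (plucker_coord A)" and "\<exists>I. plucker_coord A I \<noteq> 0"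
proof -
  have rel: "\<exists>c. plucker_coord B = (\<lambda>I. c * plucker_coord A I)"
    if AB: "A \<in> carrier_mat k n" "B \<in> carrier_mat k n" "row_span n A = W" "row_span n B = W"
    for A B
  proof -
    obtain G where "G \<in> carrier_mat k k" "B = G * A"
      using row_span_subset_imp_mult[OF AB(1,2)] AB(3,4) by auto
    then show ?thesis using plucker_coord_mult_left AB(1) by blast
  qed
  obtain A0 I0 where A0: "A0 \<in> carrier_mat k n" "row_span n A0 = W" "plucker_coord A0 I0 \<noteq> 0"
    using Gr_obtain[OF W(2)] by blast
  have nz: "plucker_coord B I0 \<noteq> 0" if "B \<in> carrier_mat k n" "row_span n B = W" for B
    using rel[OF that(1) A0(1) that(2) A0(2)] A0(3) by auto
  then show "\<exists>I. plucker_coord A I \<noteq> 0" using A W(1) by blast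
  have "proj_pt (plucker_coord B) = proj_pt (plucker_coord A)"
    if B: "B \<in> carrier_mat k n" "row_span n B = W" for B
  proof -
    obtain c where c: "plucker_coord B = (\<lambda>I. c * plucker_coord A I)"
      using rel[OF A B(1) W(1) B(2)] by blast
    then have "c \<noteq> 0" using nz[OF B] by auto
    then show ?thesis unfolding c by (rule proj_pt_scale)
  qed
  then show "plucker k n W = proj_pt (plucker_coord A)"
    unfolding plucker_def using A W(1) by blast
qed

section \<open>Block diagonal matrices\<close>

definition slice :: "nat \<Rightarrow> nat set \<Rightarrow> nat \<Rightarrow> nat set" where
  "slice q J i = {a. a < q \<and> i * q + a \<in> J}"

lemma slice_subset: "slice q J i \<subseteq> {..<q}"
  by (auto simp: slice_def)

lemma finite_slice [simp]: "finite (slice q J i)"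
  by (rule finite_subset[OF slice_subset]) simp

lemma slice_Suc: "slice q J (Suc i) = slice q {c. q + c \<in> J} i"
  by (simp add: slice_def add.assoc)

lemma slice_0: "slice q J 0 = {a \<in> J. a < q}"
  by (auto simp: slice_def)

definition diag_fun :: "nat \<Rightarrow> (nat \<Rightarrow> complex) \<Rightarrow> complex mat" where
  "diag_fun k g = mat k k (\<lambda>(r, s). if r = s then g r else 0)"

lemma diag_fun_carrier [simp]: "diag_fun k g \<in> carrier_mat k k"
  by (simp add: diag_fun_def)

lemma det_diag_fun: "det (diag_fun k g) = (\<Prod>r<k. g r)"
proof -
  have "upper_triangular (diag_fun k g)" by (auto simp: diag_fun_def)
  then have "det (diag_fun k g) = prod_list (diag_mat (diag_fun k g))"
    by (rule det_upper_triangular[OF _ diag_fun_carrier])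
  also have "diag_mat (diag_fun k g) = map g [0..<k]"
    by (simp add: diag_mat_def diag_fun_def)
  finally show ?thesis
    using prod.distinct_set_conv_list[of "[0..<k]" g] by (simp add: atLeast0LessThan)
qed

text \<open>The two sides multiply the entry in row \<open>r\<close> and column \<open>c\<close> by
  \<open>d c\<close> and by \<open>g r\<close>. For block matrices, with \<open>d\<close> constant
  on the blocks of columns, this turns a scaling of columns into one of rows.\<close>

lemma scale_cols_eq_diag_fun_mult:
  assumes B: "B \<in> carrier_mat k n"
    and eq: "\<And>r c. r < k \<Longrightarrow> c < n \<Longrightarrow> B $$ (r, c) \<noteq> 0 \<Longrightarrow> d c = g r"
  shows "scale_cols d B = diag_fun k g * B"
proof (rule eq_matI)
  fix r c assume "r < dim_row (diag_fun k g * B)" "c < dim_col (diag_fun k g * B)"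
  then have rc: "r < k" "c < n" using B by (auto simp: diag_fun_def)
  have "(diag_fun k g * B) $$ (r, c) = (\<Sum>s<k. (if r = s then g r else 0) * B $$ (s, c))"
    using B rc by (simp add: diag_fun_def scalar_prod_def atLeast0LessThan)
  also have "\<dots> = (\<Sum>s<k. if s = r then g r * B $$ (s, c) else 0)"
    by (intro sum.cong) auto
  finally show "scale_cols d B $$ (r, c) = (diag_fun k g * B) $$ (r, c)"
    using B rc eq[OF rc] by (cases "B $$ (r, c) = 0") (auto simp: scale_cols_def)
qed (use B in \<open>auto simp: scale_cols_def diag_fun_def\<close>)

text \<open>In the increasing enumeration of \<open>J\<close> the elements of the first block
  precede all others; this lets inductions over the blocks split off the first one.\<close>

lemma pick_split:
  assumes J: "J \<subseteq> {..<q + N}"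
  defines "J0 \<equiv> {a \<in> J. a < q}" and "J' \<equiv> {c. q + c \<in> J}"
  shows "card J = card J0 + card J'"
    and "J' \<subseteq> {..<N}"
    and "s < card J \<Longrightarrow>
      pick J s = (if s < card J0 then pick J0 s else q + pick J' (s - card J0))"
proof -
  have fin: "finite J0" using J by (auto intro: finite_subset simp: J0_def)
  show J': "J' \<subseteq> {..<N}" using J by (auto simp: J'_def)
  then have fin': "finite J'" by (simp add: finite_subset)
  have split: "J = J0 \<union> (+) q ` J'"
    by (auto simp: J0_def J'_def image_iff) (metis le_iff_add not_less)
  have "J0 \<inter> (+) q ` J' = {}" by (auto simp: J0_def)
  then show card: "card J = card J0 + card J'"
    unfolding split using fin fin' by (simp add: card_Un_disjoint card_image)
  let ?g = "\<lambda>s. if s < card J0 then pick J0 s else q + pick J' (s - card J0)"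
  have img: "pick J0 ` {..<card J0} = J0" "pick J' ` {..<card J'} = J'"
    using bij_betw_pick fin fin' by (auto simp: bij_betw_def)
  have "?g s < ?g t" if "s < t" "t < card J" for s t
  proof -
    have "pick J0 s < q" if "s < card J0" for s
      using pick_in_set_le[OF that] by (simp add: J0_def)
    then show ?thesis using that card pick_mono_le[of t J0 s]
        pick_mono_le[of "t - card J0" J' "s - card J0"] by (auto intro: trans_less_add1)
  qed
  moreover have "?g ` {..<card J} = J"
  proof -
    have "x \<in> (+) (card J0) ` {..<card J'}" if "x < card J0 + card J'" "\<not> x < card J0" for x
      using that by (intro image_eqI[of _ _ "x - card J0"]) auto
    then have "{..<card J} = {..<card J0} \<union> (+) (card J0) ` {..<card J'}"
      unfolding card by auto
    then have "?g ` {..<card J} = ?g ` {..<card J0} \<union> (\<lambda>s. ?g (card J0 + s)) ` {..<card J'}"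
      by (simp only: image_Un image_image)
    also have "\<dots> = pick J0 ` {..<card J0} \<union> (\<lambda>s. q + pick J' s) ` {..<card J'}"
      by (intro arg_cong2[of _ _ _ _ "(\<union>)"] image_cong) auto
    also have "\<dots> = J0 \<union> (+) q ` J'" using img by (metis image_image)
    finally show ?thesis using split by simp
  qed
  ultimately show "s < card J \<Longrightarrow> pick J s = ?g s" by (rule pick_unique)
qed

lemma card_eq_sum_slices:
  assumes "J \<subseteq> {..<p * q}"
  shows "card J = (\<Sum>i<p. card (slice q J i))"
  using assms
proof (induction p arbitrary: J)
  case (Suc p)
  have J: "J \<subseteq> {..<q + p * q}" using Suc.prems by simp
  show ?case
    using pick_split(1)[OF J] Suc.IH[OF pick_split(2)[OF J]]
    by (simp add: sum.lessThan_Suc_shift slice_Suc slice_0 del: sum.lessThan_Suc)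
qed simp

lemma diag_block_mat_carrier:
  assumes "length As = length m" and "\<And>i. i < length m \<Longrightarrow> As ! i \<in> carrier_mat (m ! i) q"
  shows "diag_block_mat As \<in> carrier_mat (sum_list m) (length m * q)"
  using assms
proof (induction As m rule: list_induct2)
  case (Cons A As x m)
  have "A \<in> carrier_mat x q" using Cons.prems[of 0] by simp
  moreover have "diag_block_mat As \<in> carrier_mat (sum_list m) (length m * q)"
    using Cons.prems[of "Suc i" for i] by (intro Cons.IH) auto
  ultimately show ?case by (auto simp: Let_def)
qed auto

text \<open>Off type, both sides vanish: scaling the columns of a block amounts to scaling its rows.\<close>

lemma plucker_coord_diag_block_mat:
  assumes "length As = length m" and "\<And>i. i < length m \<Longrightarrow> As ! i \<in> carrier_mat (m ! i) q"
    and "J \<in> ksubsets (sum_list m) (length m * q)"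
  shows "plucker_coord (diag_block_mat As) J = (\<Prod>i<length m. plucker_coord (As ! i) (slice q J i))"
  using assms
proof (induction As m arbitrary: J rule: list_induct2)
  case Nil
  then show ?case by (simp add: ksubsets_def plucker_coord_def submatrix_def)
next
  case (Cons A As x m)
  let ?k = "sum_list m" and ?n = "length m * q"
  let ?B' = "diag_block_mat As" and ?B = "diag_block_mat (A # As)"
  let ?J0 = "{a \<in> J. a < q}" and ?J' = "{c. q + c \<in> J}"
  have A: "A \<in> carrier_mat x q" using Cons.prems(1)[of 0] by simp
  have As: "As ! i \<in> carrier_mat (m ! i) q" if "i < length m" for i
    using Cons.prems(1)[of "Suc i"] that by simp
  have B': "?B' \<in> carrier_mat ?k ?n" by (rule diag_block_mat_carrier[OF Cons.hyps As])
  have B_def: "?B = four_block_mat A (0\<^sub>m x ?n) (0\<^sub>m ?k q) ?B'"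
    using A B' by (simp add: Let_def)
  have B: "?B \<in> carrier_mat (x + ?k) (q + ?n)" using A B' by (simp add: Let_def)
  have J: "J \<subseteq> {..<q + ?n}" "card J = x + ?k" using Cons.prems(2) by (auto simp: ksubsets_def)
  have J': "?J' \<subseteq> {..<?n}" by (rule pick_split(2)[OF J(1)])
  have J0: "?J0 \<subseteq> {..<q}" by auto
  have RHS: "(\<Prod>i<length (x # m). plucker_coord ((A # As) ! i) (slice q J i)) =
      plucker_coord A ?J0 * (\<Prod>i<length m. plucker_coord (As ! i) (slice q ?J' i))"
    by (simp add: prod.lessThan_Suc_shift slice_Suc slice_0 del: prod.lessThan_Suc)
  show ?case
  proof (cases "card ?J0 = x")
    case True
    then have c': "card ?J' = ?k" using pick_split(1)[OF J(1)] J(2) by simp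
    then have K: "?J' \<in> ksubsets ?k ?n" using J' by (simp add: ksubsets_def)
    let ?S = "mat x x (\<lambda>(r, s). A $$ (r, pick ?J0 s))"
    let ?S' = "mat ?k ?k (\<lambda>(r, s). ?B' $$ (r, pick ?J' s))"
    have p0: "pick ?J0 s < q" if "s < x" for s using pick_in_set_le[of s ?J0] that True by auto
    have p': "pick ?J' s < ?n" if "s < ?k" for s using pick_in_set_le[of s ?J'] that c' J' by auto
    have "mat (x + ?k) (x + ?k) (\<lambda>(r, s). ?B $$ (r, pick J s)) =
        four_block_mat ?S (0\<^sub>m x ?k) (0\<^sub>m ?k x) ?S'"
    proof (rule eq_matI)
      fix r s assume "r < dim_row (four_block_mat ?S (0\<^sub>m x ?k) (0\<^sub>m ?k x) ?S')"
        "s < dim_col (four_block_mat ?S (0\<^sub>m x ?k) (0\<^sub>m ?k x) ?S')"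
      then have rs: "r < x + ?k" "s < x + ?k" by auto
      have pick: "pick J s = (if s < x then pick ?J0 s else q + pick ?J' (s - x))"
        using pick_split(3)[OF J(1), of s] rs J(2) True by simp
      show "mat (x + ?k) (x + ?k) (\<lambda>(r, s). ?B $$ (r, pick J s)) $$ (r, s) =
          four_block_mat ?S (0\<^sub>m x ?k) (0\<^sub>m ?k x) ?S' $$ (r, s)"
        unfolding B_def using rs A B' p0[of s] p'[of "s - x"]
        by (auto simp: pick)
    qed auto
    then have "plucker_coord ?B J = det (four_block_mat ?S (0\<^sub>m x ?k) (0\<^sub>m ?k x) ?S')"
      using carrier_matD[OF B] submatrix_cols[OF B J] J
      by (simp add: plucker_coord_def del: diag_block_mat.simps)
    also have "\<dots> = det ?S * det ?S'"
      by (rule det_four_block_mat_lower_left_zero[where n = x and m = ?k]) auto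
    also have "det ?S = plucker_coord A ?J0"
      using A True J0 by (simp add: plucker_coord_def submatrix_cols)
    also have "det ?S' = plucker_coord ?B' ?J'"
      using B' c' J' by (simp add: plucker_coord_def submatrix_cols)
    also have "plucker_coord ?B' ?J' = (\<Prod>i<length m. plucker_coord (As ! i) (slice q ?J' i))"
      by (rule Cons.IH[OF As K])
    finally show ?thesis unfolding RHS .
  next
    case False
    \<comment> \<open>Weight 2 on the columns of the first block, equivalently on its rows,
      multiplies the coordinate both by \<open>2 ^ card ?J0\<close> and by \<open>2 ^ x\<close>.
      These numbers differ, so the coordinate is 0.\<close>
    let ?d = "\<lambda>c. if c < q then 2 else 1 :: complex" and ?g = "\<lambda>r. if r < x then 2 else 1 :: complex"
    have "scale_cols ?d ?B = diag_fun (x + ?k) ?g * ?B"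
    proof (rule scale_cols_eq_diag_fun_mult[OF B])
      fix r c assume "r < x + ?k" "c < q + ?n" "?B $$ (r, c) \<noteq> 0"
      then show "?d c = ?g r" unfolding B_def using A B' by (auto split: if_splits)
    qed
    then have "(\<Prod>j\<in>J. ?d j) * plucker_coord ?B J = (\<Prod>r<x + ?k. ?g r) * plucker_coord ?B J"
      using plucker_coord_scale_cols[OF B, of ?d J]
        plucker_coord_mult_left[OF diag_fun_carrier B, of ?g J] by (simp add: det_diag_fun)
    moreover have "(\<Prod>j\<in>J. ?d j) = 2 ^ card ?J0"
    proof -
      have "(\<Prod>j\<in>J. ?d j) = (\<Prod>j\<in>?J0. 2)"
        using J(1) by (intro prod.mono_neutral_cong_right) (auto intro: finite_subset)
      then show ?thesis by simp
    qed
    moreover have "(\<Prod>r<x + ?k. ?g r) = 2 ^ x"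
    proof -
      have "{..<x + ?k} \<inter> {r. r < x} = {..<x}" by auto
      then show ?thesis by (simp add: prod.If_cases)
    qed
    moreover have "(2 :: complex) ^ card ?J0 \<noteq> 2 ^ x"
    proof
      assume "(2 :: complex) ^ card ?J0 = 2 ^ x"
      then have "cmod (2 ^ card ?J0) = cmod (2 ^ x)" by simp
      then show False using False by (simp add: norm_power)
    qed
    ultimately have "plucker_coord ?B J = 0" by simp
    \<comment> \<open>Here the default value of \<open>plucker_coord\<close> for sets of the wrong
      size enters.\<close>
    moreover have "plucker_coord A ?J0 = 0" using False A by (simp add: plucker_coord_def)
    ultimately show ?thesis unfolding RHS by simp
  qed
qed

text \<open>Row reduction at the columns \<open>J\<close>. By Cramer's rule the entries of the reduced matrix are,
  up to sign, the coordinates in which one element of \<open>J\<close> is exchanged.\<close>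

lemma row_reduction:
  assumes A: "A \<in> carrier_mat k n" and J: "plucker_coord A J \<noteq> 0"
  obtains G where "G \<in> carrier_mat k k" "det G \<noteq> 0"
    "\<And>r c. r < k \<Longrightarrow> c < n \<Longrightarrow> (G * A) $$ (r, c) \<noteq> 0 \<Longrightarrow>
      plucker_coord A (insert c (J - {pick J r})) \<noteq> 0"
proof -
  have J': "J \<subseteq> {..<n}" "card J = k"
    using J plucker_coord_outside[OF A, of J] by (auto simp: ksubsets_def)
  have fin: "finite J" using J'(1) by (simp add: finite_subset)
  have pick: "pick J s \<in> J" "pick J s < n" if "s < k" for s
    using that J' pick_in_set_le[of s J] by auto
  let ?S = "mat k k (\<lambda>(r, s). A $$ (r, pick J s))"
  have S: "?S \<in> carrier_mat k k" by simp
  have "det ?S \<noteq> 0" using J J' A by (simp add: plucker_coord_def submatrix_cols)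
  then obtain G where G: "G \<in> carrier_mat k k" "G * ?S = 1\<^sub>m k"
    using det_non_zero_imp_unit[OF S, of "()"] by (auto simp: Units_def ring_mat_def)
  then have "det G * det ?S = 1" using det_mult[OF G(1) S] by simp
  then have dG: "det G \<noteq> 0" by auto
  let ?B = "G * A"
  have B: "?B \<in> carrier_mat k n" using G A by simp
  have BJ: "?B $$ (r, pick J s) = 1\<^sub>m k $$ (r, s)" if "r < k" "s < k" for r s
  proof -
    have "?B $$ (r, pick J s) = (G * ?S) $$ (r, s)"
      using G(1) A that pick by (simp add: scalar_prod_def)
    then show ?thesis using G(2) by simp
  qed
  show thesis
  proof (rule that[OF G(1) dG])
    fix r c assume r: "r < k" and c: "c < n" and nz: "?B $$ (r, c) \<noteq> 0"
    let ?f = "(pick J)(r := c)"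
    \<comment> \<open>The columns \<open>J\<close> of \<open>?B\<close> form the identity, so the
      minor at \<open>?f\<close> is that of an identity matrix with column \<open>r\<close>
      replaced. Writing the new column as \<open>1\<^sub>m k *\<^sub>v col ?B c\<close> fits it to
      Cramer's rule.\<close>
    have "mat k k (\<lambda>(i, s). ?B $$ (i, ?f s)) = replace_col (1\<^sub>m k) (1\<^sub>m k *\<^sub>v col ?B c) r"
    proof (rule eq_matI)
      fix i s assume "i < dim_row (replace_col (1\<^sub>m k) (1\<^sub>m k *\<^sub>v col ?B c) r :: complex mat)"
        "s < dim_col (replace_col (1\<^sub>m k) (1\<^sub>m k *\<^sub>v col ?B c) r :: complex mat)"
      then have ij: "i < k" "s < k" by (auto simp: replace_col_def)
      have "(1\<^sub>m k *\<^sub>v col ?B c) $ i = ?B $$ (i, c)"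
        using B c ij by (subst one_mult_mat_vec[of _ k]) (auto simp del: index_mult_mat)
      then show "mat k k (\<lambda>(i, s). ?B $$ (i, ?f s)) $$ (i, s) =
          replace_col (1\<^sub>m k) (1\<^sub>m k *\<^sub>v col ?B c) r $$ (i, s)"
        using ij BJ[OF ij] by (simp add: replace_col_def del: index_mult_mat)
    qed (auto simp: replace_col_def)
    then have "col_minor ?B ?f = det (replace_col (1\<^sub>m k) (1\<^sub>m k *\<^sub>v col ?B c) r)"
      using carrier_matD(1)[OF B] by (simp add: col_minor_def del: index_mult_mat)
    also have "\<dots> = ?B $$ (r, c)"
      using B r c by (subst cramer_lemma_mat[of _ k]) (auto simp del: index_mult_mat)
    finally have "col_minor ?B ?f \<noteq> 0" using nz by simp
    moreover have "?f \<in> {..<k} \<rightarrow> {..<n}" using pick c by auto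
    ultimately have "plucker_coord ?B (?f ` {..<k}) \<noteq> 0"
      using col_minor_eq_plucker_coord[of ?f k n] B by auto
    moreover have "?f ` {..<k} = insert c (J - {pick J r})"
    proof -
      have "pick J ` {..<k} = J" "inj_on (pick J) {..<k}"
        using bij_betw_pick[OF fin] J'(2) by (auto simp: bij_betw_def)
      moreover have "?f ` {..<k} = insert c (pick J ` ({..<k} - {r}))" using r by auto
      ultimately show ?thesis using r by (simp add: inj_on_image_set_diff[of _ "{..<k}"])
    qed
    ultimately show "plucker_coord A (insert c (J - {pick J r})) \<noteq> 0"
      using plucker_coord_mult_left[OF G(1) A] by auto
  qed
qed

text \<open>If \<open>c\<close> lay in another block than \<open>j\<close>, the block of
  \<open>c\<close> would gain an element and lose none, so the type would change.\<close>

lemma exchange_same_block: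
  assumes J: "J \<subseteq> {..<p * q}" and j: "j \<in> J" and c: "c < p * q"
    and I: "I = insert c (J - {j})" "card I = card J"
    and type: "\<And>i. i < p \<Longrightarrow> card (slice q I i) = card (slice q J i)"
  shows "c div q = j div q"
proof (rule ccontr)
  assume ne: "c div q \<noteq> j div q"
  have fin: "finite J" using J by (simp add: finite_subset)
  have q: "q > 0" using c by (cases q) auto
  have cJ: "c \<notin> J"
  proof
    assume "c \<in> J"
    then have "I = J - {j}" using I(1) ne by auto
    then show False using I(2) j fin by (metis card_Diff1_less less_irrefl)
  qed
  let ?i = "c div q"
  have i: "?i < p" using c q by (simp add: less_mult_imp_div_less)
  have "?i * q + a = c \<longleftrightarrow> a = c mod q" for a by (metis add_left_cancel div_mult_mod_eq)
  moreover have "?i * q + a \<noteq> j" if "a < q" for a using ne that by auto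
  ultimately have "slice q I ?i = insert (c mod q) (slice q J ?i)"
    using q by (auto simp: slice_def I(1))
  moreover have "c mod q \<notin> slice q J ?i" using cJ by (simp add: slice_def)
  ultimately show False using type[OF i] by simp
qed

text \<open>Row \<open>r\<close> belongs to the block of its pivot column \<open>pick J r\<close>.
  As \<open>pick J\<close> is increasing, the rows of one block are consecutive, and induction can
  split off the first block.\<close>

lemma block_entries_imp_diag_block_mat:
  assumes "q > 0" and "B \<in> carrier_mat (sum_list m) (length m * q)"
    and "J \<in> ksubsets (sum_list m) (length m * q)"
    and "\<And>i. i < length m \<Longrightarrow> card (slice q J i) = m ! i"
    and "\<And>r c. r < sum_list m \<Longrightarrow> c < length m * q \<Longrightarrow> B $$ (r, c) \<noteq> 0 \<Longrightarrow>
      c div q = pick J r div q"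
  shows "\<exists>As. length As = length m \<and> (\<forall>i<length m. As ! i \<in> carrier_mat (m ! i) q) \<and>
    B = diag_block_mat As"
  using assms(2-)
proof (induction m arbitrary: B J)
  case Nil
  then show ?case by (intro exI[of _ "[]"]) auto
next
  case (Cons x m)
  let ?k = "sum_list m" and ?n = "length m * q"
  let ?J0 = "{a \<in> J. a < q}" and ?J' = "{c. q + c \<in> J}"
  have B: "B \<in> carrier_mat (x + ?k) (q + ?n)" using Cons.prems(1) by simp
  have J: "J \<subseteq> {..<q + ?n}" "card J = x + ?k" using Cons.prems(2) by (auto simp: ksubsets_def)
  have J0: "card ?J0 = x" using Cons.prems(3)[of 0] by (simp add: slice_0)
  have J': "?J' \<in> ksubsets ?k ?n"
    using pick_split(1,2)[OF J(1)] J(2) J0 by (simp add: ksubsets_def)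
  then have cJ': "card ?J' = ?k" by (simp add: ksubsets_def)
  have pick: "pick J s = (if s < x then pick ?J0 s else q + pick ?J' (s - x))"
    if "s < x + ?k" for s using pick_split(3)[OF J(1), of s] that J(2) J0 by simp
  have block: "c div q = pick J r div q" if "r < x + ?k" "c < q + ?n" "B $$ (r, c) \<noteq> 0" for r c
    using Cons.prems(4)[of r c] that by simp
  define A where "A = mat x q (\<lambda>(r, c). B $$ (r, c))"
  define B' where "B' = mat ?k ?n (\<lambda>(r, c). B $$ (x + r, q + c))"
  have "\<exists>As. length As = length m \<and> (\<forall>i<length m. As ! i \<in> carrier_mat (m ! i) q) \<and>
      B' = diag_block_mat As"
  proof (rule Cons.IH[OF _ J'])
    show "B' \<in> carrier_mat ?k ?n" by (simp add: B'_def)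
    show "card (slice q ?J' i) = m ! i" if "i < length m" for i
      using Cons.prems(3)[of "Suc i"] that by (simp add: slice_Suc)
    show "c div q = pick ?J' r div q" if "r < ?k" "c < ?n" "B' $$ (r, c) \<noteq> 0" for r c
      using block[of "x + r" "q + c"] that pick[of "x + r"] assms(1) by (simp add: B'_def)
  qed
  then obtain As where As: "length As = length m" "\<forall>i<length m. As ! i \<in> carrier_mat (m ! i) q"
    "B' = diag_block_mat As" by blast
  have "B = four_block_mat A (0\<^sub>m x ?n) (0\<^sub>m ?k q) B'"
  proof (rule eq_matI)
    fix r c assume "r < dim_row (four_block_mat A (0\<^sub>m x ?n) (0\<^sub>m ?k q) B')"
      "c < dim_col (four_block_mat A (0\<^sub>m x ?n) (0\<^sub>m ?k q) B')"
    then have rc: "r < x + ?k" "c < q + ?n" by (auto simp: A_def B'_def)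
    have "B $$ (r, c) = 0" if "r < x" "\<not> c < q"
    proof (rule ccontr)
      assume "B $$ (r, c) \<noteq> 0"
      then have "c div q = pick ?J0 r div q" using block[OF rc] that(1)
        unfolding pick[OF rc(1)] by simp
      moreover have "pick ?J0 r < q" using pick_in_set_le[of r ?J0] that J0 by simp
      ultimately have "c div q = 0" by simp
      then show False using that assms(1) by (simp add: div_eq_0_iff)
    qed
    moreover have "B $$ (r, c) = 0" if "\<not> r < x" "c < q"
    proof (rule ccontr)
      assume "B $$ (r, c) \<noteq> 0"
      then have "c div q = (q + pick ?J' (r - x)) div q"
        using block[OF rc] that(1) unfolding pick[OF rc(1)] by simp
      then show False using that assms(1) by simp
    qed
    ultimately show "B $$ (r, c) = four_block_mat A (0\<^sub>m x ?n) (0\<^sub>m ?k q) B' $$ (r, c)"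
      using rc by (auto simp: A_def B'_def)
  qed (use B in \<open>auto simp: A_def B'_def\<close>)
  also have "\<dots> = diag_block_mat (A # As)"
    using As(3)[symmetric] by (simp add: Let_def) (simp add: A_def B'_def)
  finally show ?case using As(1,2)
    by (intro exI[of _ "A # As"]) (auto simp: A_def nth_Cons split: nat.splits)
qed

section \<open>An eigenbasis of a power of the cyclic shift\<close>

lemma ex_distinct_roots:
  assumes "p > 0" "c \<noteq> 0"
  shows "\<exists>ev. inj_on ev {..<p} \<and> (\<forall>i<p. ev i ^ p = (c :: complex))"
proof -
  have "card {z :: complex. z ^ p = c} = p" using card_nth_roots assms by blast
  moreover have "finite {z :: complex. z ^ p = c}"
    using calculation assms(1) by (intro card_ge_0_finite) simp
  ultimately obtain ev where "bij_betw ev {0..<p} {z :: complex. z ^ p = c}"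
    using ex_bij_betw_nat_finite by metis
  then show ?thesis by (intro exI[of _ ev]) (auto simp: bij_betw_def atLeast0LessThan)
qed

text \<open>The quotient \<open>w\<close> of two of the roots satisfies \<open>w ^ p = 1\<close>. If
  also \<open>w ^ e = 1\<close>, Bezout gives \<open>w = 1\<close>.\<close>

lemma inj_on_power_coprime:
  assumes "inj_on ev {..<p}" "\<And>i. i < p \<Longrightarrow> ev i ^ p = (c :: complex)" "c \<noteq> 0" "coprime e p" "e > 0"
  shows "inj_on (\<lambda>i. ev i ^ e) {..<p}"
proof (rule inj_onI)
  fix i j assume ij: "i \<in> {..<p}" "j \<in> {..<p}" and eq: "ev i ^ e = ev j ^ e"
  have "ev j ^ p \<noteq> 0" using assms(2)[of j] assms(3) ij by simp
  then have nz: "ev j \<noteq> 0" using ij by (auto simp: power_0_left)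
  let ?w = "ev i / ev j"
  have we: "?w ^ e = 1" using eq nz by (simp add: power_divide)
  have wp: "?w ^ p = 1" using assms(2,3) ij by (simp add: power_divide)
  obtain x y where "e * x = p * y + 1" using bezout_nat[of e p] assms(4,5) by auto
  then have "(?w ^ e) ^ x = (?w ^ p) ^ y * ?w" by (simp flip: power_mult)
  then have "?w = 1" using we wp by simp
  then have "ev i = ev j" using nz by simp
  then show "i = j" using assms(1) ij by (simp add: inj_on_def)
qed

lemma sum_residue_class:
  fixes f :: "nat \<Rightarrow> 'a :: comm_monoid_add"
  assumes "a < q"
  shows "(\<Sum>c<p * q. if c mod q = a then f (c div q) else 0) = (\<Sum>t<p. f t)"
proof -
  have "(\<Sum>c<p * q. if c mod q = a then f (c div q) else 0) =
      (\<Sum>c | c \<in> {..<p * q} \<and> c mod q = a. f (c div q))"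
    by (rule sum.inter_filter[symmetric]) simp
  also have "\<dots> = (\<Sum>t<p. f t)"
  proof (rule sum.reindex_bij_witness[of _ "\<lambda>t. t * q + a" "\<lambda>c. c div q"])
    show "c div q * q + a = c" if "c \<in> {c. c \<in> {..<p * q} \<and> c mod q = a}" for c
      using that div_mult_mod_eq[of c q] by simp
    show "c div q \<in> {..<p}" if "c \<in> {c. c \<in> {..<p * q} \<and> c mod q = a}" for c
      using that by (simp add: less_mult_imp_div_less)
    show "t * q + a \<in> {c. c \<in> {..<p * q} \<and> c mod q = a}" if "t \<in> {..<p}" for t
    proof -
      have "t * q + a < Suc t * q" using assms by simp
      also have "\<dots> \<le> p * q" using that by (intro mult_right_mono) auto
      finally show ?thesis using assms by simp
    qed
  qed (use assms in auto)
  finally show ?thesis .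
qed

text \<open>In at most \<open>n\<close> steps an entry wraps around at most once, so the sign occurs
  at most once.\<close>

lemma shift_vec_funpow:
  assumes "x \<in> carrier_vec n" "j \<le> n" "n \<ge> 1"
  shows "(shift_vec k n ^^ j) x =
    vec n (\<lambda>c. if c + j < n then x $ (c + j) else (-1) ^ (k - 1) * x $ (c + j - n))"
  using assms(2)
proof (induction j)
  case 0
  then show ?case using assms(1) by (auto intro!: eq_vecI)
next
  case (Suc j)
  have step: "(shift_vec k n ^^ Suc j) x = shift_vec k n (vec n (\<lambda>c. if c + j < n then x $ (c + j)
      else (-1) ^ (k - 1) * x $ (c + j - n)))"
    using Suc by simp
  show ?case
    unfolding step
  proof (rule eq_vecI)
    fix c assume "c < dim_vec (vec n (\<lambda>c. if c + Suc j < n then x $ (c + Suc j)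
      else (-1) ^ (k - 1) * x $ (c + Suc j - n)))"
    then have c: "c < n" by simp
    show "shift_vec k n (vec n (\<lambda>c. if c + j < n then x $ (c + j)
      else (-1) ^ (k - 1) * x $ (c + j - n))) $ c = vec n (\<lambda>c. if c + Suc j < n then x $ (c + Suc j)
      else (-1) ^ (k - 1) * x $ (c + Suc j - n)) $ c"
    proof (cases "Suc c < n")
      case True
      then show ?thesis using c by (simp add: shift_vec_def)
    next
      case False
      \<comment> \<open>This is the position \<open>c = n - 1\<close>, which receives entry 0 of the
        previous vector, that is \<open>x $ j\<close>, with the sign.\<close>
      then have "c + Suc j - n = j" "\<not> c + Suc j < n" using c by auto
      then show ?thesis using Suc.prems c False by (simp add: shift_vec_def)
    qed
  qed (simp add: shift_vec_def)
qed

lemma cyc_shift_funpow: "(cyc_shift k n ^^ j) W = (shift_vec k n ^^ j) ` W"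
  by (induction j) (simp_all add: cyc_shift_def image_image)

lemma scale_cols_scale_cols:
  "scale_cols d (scale_cols e A) = scale_cols (\<lambda>c. d c * e c) A"
  by (auto simp: scale_cols_def intro!: eq_matI)

lemma scale_cols_one: "scale_cols (\<lambda>_. 1) A = A"
  by (auto simp: scale_cols_def intro!: eq_matI)

locale shift_eigenbasis =
  fixes k n p q :: nat and ev :: "nat \<Rightarrow> complex"
  assumes n: "n = p * q" and p: "p > 0" and q: "q > 0"
    and ev_root: "\<And>i. i < p \<Longrightarrow> ev i ^ p = (-1) ^ (k - 1)"
    and ev_inj: "inj_on ev {..<p}"
begin

text \<open>The rows \<open>i q, \<dots>, i q + q - 1\<close> of \<open>eig\<close> form a basis of the eigenspace of the \<open>q\<close>-th
  power of the shift for \<open>ev i\<close>.\<close>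

definition eig :: "complex mat" where
  "eig = mat n n (\<lambda>(u, c). if c mod q = u mod q then ev (u div q) ^ (c div q) else 0)"

text \<open>On a residue class modulo \<open>q\<close>, \<open>eig\<close> is the Vandermonde matrix
  of the numbers \<open>ev i\<close>. Their ratios being \<open>p\<close>-th roots of unity, it is
  inverted as a discrete Fourier matrix is: transpose, invert the entries, divide by
  \<open>p\<close>.\<close>

definition eig_inv :: "complex mat" where
  "eig_inv = mat n n (\<lambda>(c, u).
     if c mod q = u mod q then inverse (of_nat p * ev (u div q) ^ (c div q)) else 0)"

lemma eig_carrier [simp]: "eig \<in> carrier_mat n n" "eig_inv \<in> carrier_mat n n"
  by (simp_all add: eig_def eig_inv_def)

lemma div_less_p: "c < n \<Longrightarrow> c div q < p"
  using n by (simp add: less_mult_imp_div_less)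

lemma ev_nonzero: "i < p \<Longrightarrow> ev i \<noteq> 0"
  using ev_root[of i] p by (auto simp: power_0_left)

lemma eig_mult_inv: "eig * eig_inv = 1\<^sub>m n"
proof (rule eq_matI)
  fix u u' assume "u < dim_row (1\<^sub>m n :: complex mat)" "u' < dim_col (1\<^sub>m n :: complex mat)"
  then have u: "u < n" "u' < n" by auto
  let ?x = "ev (u div q)" and ?y = "ev (u' div q)"
  have y: "?y \<noteq> 0" using ev_nonzero div_less_p u by blast
  have "(eig * eig_inv) $$ (u, u') = (\<Sum>c<n. eig $$ (u, c) * eig_inv $$ (c, u'))"
    using u by (simp add: eig_def eig_inv_def scalar_prod_def atLeast0LessThan)
  also have "\<dots> = 1\<^sub>m n $$ (u, u')"
  proof (cases "u mod q = u' mod q")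
    case False
    then have "u \<noteq> u'" by auto
    moreover have "eig $$ (u, c) * eig_inv $$ (c, u') = 0" if "c < n" for c
      using False u that by (auto simp: eig_def eig_inv_def)
    then have "(\<Sum>c<n. eig $$ (u, c) * eig_inv $$ (c, u')) = 0" by (intro sum.neutral) simp
    ultimately show ?thesis using u by simp
  next
    case True
    have "(\<Sum>c<n. eig $$ (u, c) * eig_inv $$ (c, u')) =
        (\<Sum>c<p * q. if c mod q = u mod q then (?x / ?y) ^ (c div q) / of_nat p else 0)"
      unfolding n[symmetric] using True u y
      by (intro sum.cong) (auto simp: eig_def eig_inv_def field_simps power_divide)
    also have "\<dots> = (\<Sum>t<p. (?x / ?y) ^ t / of_nat p)"
      using q by (intro sum_residue_class) simp
    also have "\<dots> = (\<Sum>t<p. (?x / ?y) ^ t) / of_nat p" by (simp add: sum_divide_distrib)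
    also have "\<dots> = 1\<^sub>m n $$ (u, u')"
    proof (cases "u div q = u' div q")
      case eq: True
      then have "u = u'" using True by (metis div_mult_mod_eq)
      then show ?thesis using u y p by simp
    next
      case False
      then have "?x \<noteq> ?y" using ev_inj div_less_p u unfolding inj_on_def by blast
      then have "?x / ?y \<noteq> 1" using y by simp
      moreover have "(?x / ?y) ^ p = 1"
        using ev_root div_less_p u by (simp add: power_divide)
      ultimately have "(\<Sum>t<p. (?x / ?y) ^ t) = 0" by (simp add: geometric_sum)
      moreover have "u \<noteq> u'" using False by auto
      ultimately show ?thesis using u by simp
    qed
    finally show ?thesis .
  qed
  finally show "(eig * eig_inv) $$ (u, u') = 1\<^sub>m n $$ (u, u')" .
qed (simp_all add: eig_def eig_inv_def)

lemma inv_mult_eig: "eig_inv * eig = 1\<^sub>m n"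
  using mat_mult_left_right_inverse[OF _ _ eig_mult_inv] by simp

lemma mult_eig_inv [simp]: "A \<in> carrier_mat r n \<Longrightarrow> A * eig_inv * eig = A"
  using inv_mult_eig by (simp add: assoc_mult_mat[of A r n eig_inv n eig n])

lemma mult_inv_eig [simp]: "A \<in> carrier_mat r n \<Longrightarrow> A * eig * eig_inv = A"
  using eig_mult_inv by (simp add: assoc_mult_mat[of A r n eig n eig_inv n])

text \<open>A step by \<open>q\<close> raises the exponent \<open>c div q\<close> by one. In the
  last block it returns to 0 instead, and the sign makes up for the missing factor
  \<open>ev i ^ p\<close>.\<close>

lemma shift_eig:
  assumes u: "u < n" and c: "c < n"
  shows "(if c + q < n then eig $$ (u, c + q) else (-1) ^ (k - 1) * eig $$ (u, c + q - n)) =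
    ev (u div q) * eig $$ (u, c)"
proof (cases "c + q < n")
  case True
  then show ?thesis using u q by (simp add: eig_def)
next
  case False
  have "p - 1 \<le> c div q"
  proof -
    have "p * q \<le> c + q" using False n by simp
    then have "(p * q) div q \<le> (c + q) div q" by (rule div_le_mono)
    then show ?thesis using q by simp
  qed
  then have cp: "c div q = p - 1" using div_less_p[OF c] by simp
  have "c = (p - 1) * q + c mod q" using div_mult_mod_eq[of c q] cp by metis
  moreover have "(p - 1) * q + q = n" using n p by (cases p) auto
  ultimately have c': "c + q - n = c mod q" by linarith
  have "c mod q < n" using c mod_less_eq_dividend[of c q] by linarith
  moreover have "ev (u div q) * ev (u div q) ^ (p - 1) = (-1) ^ (k - 1)"
    using ev_root[OF div_less_p[OF u]] p by (simp flip: power_Suc)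
  ultimately show ?thesis using False u c c' cp q by (simp add: eig_def)
qed

text \<open>The vector \<open>transpose_mat B *\<^sub>v y\<close> holds the coordinates of a vector
  of the span with respect to the eigenbasis; on these the power of the shift acts diagonally, which
  scales the columns of \<open>B\<close>.\<close>

lemma row_span_mult_eig:
  assumes B: "B \<in> carrier_mat r n"
  shows "row_span n (B * eig) =
    (\<lambda>y. vec n (\<lambda>c. \<Sum>u<n. eig $$ (u, c) * (transpose_mat B *\<^sub>v y) $ u)) ` carrier_vec r"
proof -
  have "transpose_mat (B * eig) *\<^sub>v y =
      vec n (\<lambda>c. \<Sum>u<n. eig $$ (u, c) * (transpose_mat B *\<^sub>v y) $ u)" if "y \<in> carrier_vec r" for y
  proof -
    have "transpose_mat (B * eig) *\<^sub>v y = transpose_mat eig *\<^sub>v (transpose_mat B *\<^sub>v y)"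
      using B that by (simp add: transpose_mult[of _ r n _ n] assoc_mult_mat_vec[of _ n n _ r])
    also have "\<dots> = vec n (\<lambda>c. \<Sum>u<n. eig $$ (u, c) * (transpose_mat B *\<^sub>v y) $ u)"
      using B carrier_matD[OF eig_carrier(1)]
      by (intro eq_vecI) (auto simp: scalar_prod_def atLeast0LessThan intro!: sum.cong)
    finally show ?thesis .
  qed
  then have "(\<lambda>y. transpose_mat (B * eig) *\<^sub>v y) ` carrier_vec r =
      (\<lambda>y. vec n (\<lambda>c. \<Sum>u<n. eig $$ (u, c) * (transpose_mat B *\<^sub>v y) $ u)) ` carrier_vec r"
    by (intro image_cong) auto
  moreover have "B * eig \<in> carrier_mat r n" using B by simp
  ultimately show ?thesis by (simp add: row_span_eq[of _ r] setcompr_eq_image)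
qed

lemma cyc_shift_q_row_span:
  assumes B: "B \<in> carrier_mat r n"
  shows "(cyc_shift k n ^^ q) (row_span n (B * eig)) =
    row_span n (scale_cols (\<lambda>c. ev (c div q)) B * eig)"
proof -
  let ?d = "\<lambda>c. ev (c div q)"
  let ?v = "\<lambda>w. vec n (\<lambda>c. \<Sum>u<n. eig $$ (u, c) * w $ u)"
  have qn: "q \<le> n" "n \<ge> 1" using n p q by auto
  have "(shift_vec k n ^^ q) (?v (transpose_mat B *\<^sub>v y)) =
      ?v (transpose_mat (scale_cols ?d B) *\<^sub>v y)" if y: "y \<in> carrier_vec r" for y
  proof -
    let ?w = "transpose_mat B *\<^sub>v y"
    have scale: "(transpose_mat (scale_cols ?d B) *\<^sub>v y) $ u = ?d u * ?w $ u" if "u < n" for u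
      using B y that
      by (auto simp: scale_cols_def scalar_prod_def sum_distrib_left intro!: sum.cong)
    show ?thesis
    proof (rule eq_vecI)
      fix c assume "c < dim_vec (?v (transpose_mat (scale_cols ?d B) *\<^sub>v y))"
      then have c: "c < n" by simp
      have "(shift_vec k n ^^ q) (?v ?w) $ c = (\<Sum>u<n. (if c + q < n then eig $$ (u, c + q)
          else (-1) ^ (k - 1) * eig $$ (u, c + q - n)) * ?w $ u)"
        using c qn by (auto simp: shift_vec_funpow sum_distrib_left mult.assoc)
      also have "\<dots> = (\<Sum>u<n. eig $$ (u, c) * (transpose_mat (scale_cols ?d B) *\<^sub>v y) $ u)"
        using c by (intro sum.cong) (simp_all add: shift_eig scale)
      finally show "(shift_vec k n ^^ q) (?v ?w) $ c =
          ?v (transpose_mat (scale_cols ?d B) *\<^sub>v y) $ c" using c by simp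
    qed (use qn in \<open>simp add: shift_vec_funpow\<close>)
  qed
  then show ?thesis
    unfolding cyc_shift_funpow row_span_mult_eig[OF B]
      row_span_mult_eig[OF scale_cols_carrier[OF B]] image_image
    by (intro image_cong refl)
qed

lemma cyc_shift_mult_row_span:
  assumes B: "B \<in> carrier_mat r n"
  shows "(cyc_shift k n ^^ (q * e)) (row_span n (B * eig)) =
    row_span n (scale_cols (\<lambda>c. ev (c div q) ^ e) B * eig)"
proof (induction e)
  case 0
  then show ?case by (simp add: scale_cols_one)
next
  case (Suc e)
  have "(cyc_shift k n ^^ (q * Suc e)) (row_span n (B * eig)) =
      (cyc_shift k n ^^ q) ((cyc_shift k n ^^ (q * e)) (row_span n (B * eig)))"
    by (simp add: funpow_add)
  then show ?case
    unfolding Suc using cyc_shift_q_row_span[OF scale_cols_carrier[OF B]]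
    by (simp add: scale_cols_scale_cols)
qed

end

text \<open>Diagonal operators that map the row span of \<open>B\<close> into itself form an algebra
  with unit. Closure under products holds because scaling columns commutes with multiplication from
  the left.\<close>

lemma stabilized_scalings:
  fixes B :: "complex mat"
  assumes B: "B \<in> carrier_mat k n"
  defines "S \<equiv> {d. \<exists>G\<in>carrier_mat k k. scale_cols d B = G * B}"
  shows "(\<lambda>_. a) \<in> S"
    and "d \<in> S \<Longrightarrow> e \<in> S \<Longrightarrow> (\<lambda>c. d c + e c) \<in> S"
    and "d \<in> S \<Longrightarrow> e \<in> S \<Longrightarrow> (\<lambda>c. d c * e c) \<in> S"
proof -
  have "scale_cols (\<lambda>_. a) B = (a \<cdot>\<^sub>m 1\<^sub>m k) * B"
    using B by (intro eq_matI) (auto simp: scale_cols_def)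
  then show "(\<lambda>_. a) \<in> S" unfolding S_def by auto
  show "(\<lambda>c. d c + e c) \<in> S" if de: "d \<in> S" "e \<in> S"
  proof -
    obtain G H where GH: "G \<in> carrier_mat k k" "scale_cols d B = G * B"
      "H \<in> carrier_mat k k" "scale_cols e B = H * B" using de unfolding S_def by auto
    have "scale_cols (\<lambda>c. d c + e c) B = scale_cols d B + scale_cols e B"
      using B by (intro eq_matI) (auto simp: scale_cols_def algebra_simps)
    also have "\<dots> = (G + H) * B" using GH B by (simp add: add_mult_distrib_mat[of _ k k])
    finally show ?thesis unfolding S_def using GH by auto
  qed
  show "(\<lambda>c. d c * e c) \<in> S" if de: "d \<in> S" "e \<in> S"
  proof -
    obtain G H where GH: "G \<in> carrier_mat k k" "scale_cols d B = G * B"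
      "H \<in> carrier_mat k k" "scale_cols e B = H * B" using de unfolding S_def by auto
    have "scale_cols (\<lambda>c. d c * e c) B = scale_cols d (H * B)"
      using GH(4) by (simp flip: scale_cols_scale_cols)
    also have "\<dots> = H * scale_cols d B"
      using GH(3) B
      by (intro eq_matI) (auto simp: scale_cols_def scalar_prod_def sum_distrib_right mult.assoc)
    also have "\<dots> = H * G * B" using GH B by (simp add: assoc_mult_mat[of _ k k])
    finally show ?thesis unfolding S_def using GH by auto
  qed
qed

text \<open>The Lagrange polynomial for \<open>\<mu> i\<close> with nodes \<open>\<mu> j\<close>
  turns the scaling by \<open>\<mu>\<close> into the indicator of block \<open>i\<close>. Adding 1
  gives weight 2 on this block and 1 elsewhere.\<close>

lemma stabilized_indicator:
  fixes B :: "complex mat" and \<mu> :: "nat \<Rightarrow> complex"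
  assumes B: "B \<in> carrier_mat k (p * q)" and G: "G \<in> carrier_mat k k"
    and stab: "scale_cols (\<lambda>c. \<mu> (c div q)) B = G * B" and inj: "inj_on \<mu> {..<p}" and i: "i < p"
  shows "\<exists>H\<in>carrier_mat k k. scale_cols (\<lambda>c. if c div q = i then 2 else 1) B = H * B"
proof -
  let ?S = "{d. \<exists>G\<in>carrier_mat k k. scale_cols d B = G * B}"
  note S = stabilized_scalings[OF B]
  let ?lin = "\<lambda>j c. inverse (\<mu> i - \<mu> j) * (\<mu> (c div q) + - \<mu> j)"
  have base: "(\<lambda>c. \<mu> (c div q)) \<in> ?S" using G stab by blast
  have lin: "?lin j \<in> ?S" for j by (rule S(3)[OF S(1) S(2)[OF base S(1)]])
  have "(\<lambda>c. \<Prod>j\<in>F. ?lin j c) \<in> ?S" if "finite F" for F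
    using that
  proof induction
    case empty
    then show ?case using S(1) by simp
  next
    case (insert j F)
    have "(\<lambda>c. \<Prod>j\<in>insert j F. ?lin j c) = (\<lambda>c. ?lin j c * (\<Prod>j\<in>F. ?lin j c))"
      using insert.hyps by (intro ext prod.insert)
    then show ?case using S(3)[OF lin[of j] insert.IH] by (simp only:)
  qed
  then have "(\<lambda>c. 1 + (\<Prod>j\<in>{..<p} - {i}. ?lin j c)) \<in> ?S" by (intro S(2) S(1)) simp
  then obtain H where H: "H \<in> carrier_mat k k"
    "scale_cols (\<lambda>c. 1 + (\<Prod>j\<in>{..<p} - {i}. ?lin j c)) B = H * B" by auto
  have "1 + (\<Prod>j\<in>{..<p} - {i}. ?lin j c) = (if c div q = i then 2 else 1)" if "c < p * q" for c
  proof (cases "c div q = i")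
    case True
    have "?lin j c = 1" if "j \<in> {..<p} - {i}" for j
    proof -
      have "\<mu> i \<noteq> \<mu> j" using that inj i unfolding inj_on_def by auto
      then show ?thesis using True by simp
    qed
    then show ?thesis using True by simp
  next
    case False
    have "c div q < p" using that by (simp add: less_mult_imp_div_less)
    then have "(\<Prod>j\<in>{..<p} - {i}. ?lin j c) = 0" using False by (intro prod_zero) auto
    then show ?thesis using False by simp
  qed
  then have "scale_cols (\<lambda>c. if c div q = i then 2 else 1) B =
      scale_cols (\<lambda>c. 1 + (\<Prod>j\<in>{..<p} - {i}. ?lin j c)) B"
    using B by (intro eq_matI) (auto simp: scale_cols_def)
  then show ?thesis using H by auto
qed

section \<open>The strata of the fixed locus\<close>

context shift_eigenbasis
begin

definition has_type :: "nat list \<Rightarrow> nat set \<Rightarrow> bool" where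
  "has_type m J \<longleftrightarrow> (\<forall>i<p. card (slice q J i) = m ! i)"

text \<open>The columns of \<open>A * eig_inv\<close> are the coordinates with respect to the
  eigenbasis. Quantifying over all matrices of \<open>W\<close> makes this a property of
  \<open>W\<close>; by proportionality of coordinates one full rank matrix decides it.\<close>

definition stratum :: "nat list \<Rightarrow> complex vec set set" where
  "stratum m = {W \<in> Gr k n. \<forall>A\<in>carrier_mat k n. row_span n A = W \<longrightarrow>
     (\<forall>J. plucker_coord (A * eig_inv) J \<noteq> 0 \<longrightarrow> has_type m J)}"

text \<open>Coordinates of a product are combinations of those of the left factor, so simultaneous
  vanishing passes through \<open>eig\<close>, and back through \<open>eig_inv\<close>.\<close>

lemma plucker_coord_eig_nonzero:
  assumes B: "B \<in> carrier_mat k n"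
  shows "(\<exists>J. plucker_coord (B * eig) J \<noteq> 0) \<longleftrightarrow> (\<exists>J. plucker_coord B J \<noteq> 0)"
proof -
  have imp: "\<exists>J. plucker_coord A J \<noteq> 0"
    if M: "A \<in> carrier_mat k n" "M \<in> carrier_mat n n" "plucker_coord (A * M) J \<noteq> 0" for A M J
  proof (rule ccontr)
    assume "\<not> (\<exists>J. plucker_coord A J \<noteq> 0)"
    moreover obtain C where "\<forall>A\<in>carrier_mat k n. \<forall>J.
        plucker_coord (A * M) J = (\<Sum>I\<in>ksubsets k n. C J I * plucker_coord A I)"
      using plucker_coord_mult_right[OF M(2)] by blast
    ultimately show False using M(1,3) by simp
  qed
  have "\<exists>J. plucker_coord (B * eig) J \<noteq> 0" if "plucker_coord B J \<noteq> 0" for J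
    using imp[of "B * eig" eig_inv J] that B by simp
  then show ?thesis using imp[OF B eig_carrier(1)] by blast
qed

lemma Gr_eig_I:
  "B \<in> carrier_mat k n \<Longrightarrow> plucker_coord B J \<noteq> 0 \<Longrightarrow> row_span n (B * eig) \<in> Gr k n"
  using plucker_coord_eig_nonzero[of B] Gr_I[of "B * eig" k n] by auto

lemma Gr_eig_obtain:
  assumes "W \<in> Gr k n"
  obtains B J where "B \<in> carrier_mat k n" "row_span n (B * eig) = W" "plucker_coord B J \<noteq> 0"
proof -
  obtain A where A: "A \<in> carrier_mat k n" "row_span n A = W" "\<exists>I. plucker_coord A I \<noteq> 0"
    using Gr_obtain[OF assms] by blast
  have "A * eig_inv \<in> carrier_mat k n" using A(1) by simp
  then show thesis
    using that[of "A * eig_inv"] plucker_coord_eig_nonzero[of "A * eig_inv"] A by auto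
qed

lemma stratum_iff:
  assumes B: "B \<in> carrier_mat k n" and nz: "plucker_coord B J0 \<noteq> 0"
  shows "row_span n (B * eig) \<in> stratum m \<longleftrightarrow> (\<forall>J. plucker_coord B J \<noteq> 0 \<longrightarrow> has_type m J)"
proof
  assume "row_span n (B * eig) \<in> stratum m"
  moreover have "B * eig \<in> carrier_mat k n" using B by simp
  ultimately show "\<forall>J. plucker_coord B J \<noteq> 0 \<longrightarrow> has_type m J"
    unfolding stratum_def using mult_inv_eig[OF B] by auto
next
  assume type: "\<forall>J. plucker_coord B J \<noteq> 0 \<longrightarrow> has_type m J"
  have "has_type m J" if A: "A \<in> carrier_mat k n" "row_span n A = row_span n (B * eig)"
    and J: "plucker_coord (A * eig_inv) J \<noteq> 0" for A J
  proof -
    have BE: "B * eig \<in> carrier_mat k n" using B by simp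
    obtain G where G: "G \<in> carrier_mat k k" "A = G * (B * eig)"
      using row_span_subset_imp_mult[OF BE A(1)] A(2) by auto
    have "A * eig_inv = G * B"
      using G B by (simp add: assoc_mult_mat[of G k k "B * eig" n eig_inv n])
    then have "plucker_coord B J \<noteq> 0" using J plucker_coord_mult_left[OF G(1) B] by auto
    then show ?thesis using type by blast
  qed
  then show "row_span n (B * eig) \<in> stratum m"
    unfolding stratum_def using Gr_eig_I[OF B nz] by blast
qed

lemma stratum_subset_Gr: "stratum m \<subseteq> Gr k n"
  by (auto simp: stratum_def)

text \<open>One nonvanishing coordinate determines the type; \<open>has_type\<close> looks only at
  the entries below \<open>p\<close>, hence the condition on the lengths.\<close>

lemma stratum_disjoint:
  assumes "W \<in> stratum m" "W \<in> stratum m'" "length m = p" "length m' = p"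
  shows "m = m'"
proof -
  obtain B J where "B \<in> carrier_mat k n" "row_span n (B * eig) = W" "plucker_coord B J \<noteq> 0"
    using Gr_eig_obtain stratum_subset_Gr assms(1) by blast
  then have "has_type m J" "has_type m' J" using stratum_iff assms(1,2) by blast+
  then show ?thesis using assms(3,4) by (intro nth_equalityI) (auto simp: has_type_def)
qed

text \<open>A nonzero entry of the reduced matrix comes from a nonvanishing coordinate with one
  element of \<open>J\<close> exchanged. Its type is again \<open>m\<close>, so the exchange stays
  within the block of the pivot.\<close>

lemma stratum_normal_form:
  assumes W: "W \<in> stratum m"
  obtains B J where "B \<in> carrier_mat k n" "row_span n (B * eig) = W" "plucker_coord B J \<noteq> 0"
    "\<And>r c. r < k \<Longrightarrow> c < n \<Longrightarrow> B $$ (r, c) \<noteq> 0 \<Longrightarrow> c div q = pick J r div q"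
proof -
  obtain A J where A: "A \<in> carrier_mat k n" "row_span n (A * eig) = W" and J: "plucker_coord A J \<noteq> 0"
    using Gr_eig_obtain stratum_subset_Gr W by blast
  have type: "has_type m I" if "plucker_coord A I \<noteq> 0" for I
    using stratum_iff[OF A(1) J] A(2) W that by blast
  have Jk: "J \<subseteq> {..<p * q}" "card J = k"
    using J plucker_coord_outside[OF A(1), of J] n by (auto simp: ksubsets_def)
  obtain G where G: "G \<in> carrier_mat k k" "det G \<noteq> 0"
    and entries: "\<And>r c. r < k \<Longrightarrow> c < n \<Longrightarrow> (G * A) $$ (r, c) \<noteq> 0 \<Longrightarrow>
      plucker_coord A (insert c (J - {pick J r})) \<noteq> 0"
    using row_reduction[OF A(1) J] by blast
  show thesis
  proof (rule that)
    show "G * A \<in> carrier_mat k n" using G A by simp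
    have "G * A * eig = G * (A * eig)"
      using G A by (simp add: assoc_mult_mat[of G k k A n eig n])
    then show "row_span n (G * A * eig) = W"
      using row_span_mult_left[OF G, of "A * eig" n] A by simp
    show "plucker_coord (G * A) J \<noteq> 0" using plucker_coord_mult_left[OF G(1) A(1)] G J by simp
    fix r c assume rc: "r < k" "c < n" and nz: "(G * A) $$ (r, c) \<noteq> 0"
    define I where "I = insert c (J - {pick J r})"
    have I: "plucker_coord A I \<noteq> 0" unfolding I_def by (rule entries[OF rc nz])
    then have "card I = card J"
      using plucker_coord_outside[OF A(1), of I] Jk(2) by (auto simp: ksubsets_def)
    moreover have "pick J r \<in> J" using pick_in_set_le[of r J] rc Jk(2) by simp
    moreover have "card (slice q I i) = card (slice q J i)" if "i < p" for i
      using type[OF I] type[OF J] that by (simp add: has_type_def)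
    ultimately show "c div q = pick J r div q"
      using exchange_same_block[OF Jk(1) _ _ I_def] rc n by blast
  qed
qed

text \<open>In normal form every row lies in a single eigenspace, so the operator multiplies the
  rows by nonzero numbers.\<close>

lemma stratum_fixed:
  assumes W: "W \<in> stratum m"
  shows "(cyc_shift k n ^^ (q * e)) W = W"
proof -
  obtain B J where B: "B \<in> carrier_mat k n" "row_span n (B * eig) = W" "plucker_coord B J \<noteq> 0"
    and entries: "\<And>r c. r < k \<Longrightarrow> c < n \<Longrightarrow> B $$ (r, c) \<noteq> 0 \<Longrightarrow> c div q = pick J r div q"
    using stratum_normal_form[OF W] by blast
  have J: "J \<subseteq> {..<n}" "card J = k"
    using B(3) plucker_coord_outside[OF B(1), of J] by (auto simp: ksubsets_def)
  let ?g = "\<lambda>r. ev (pick J r div q) ^ e"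
  have "scale_cols (\<lambda>c. ev (c div q) ^ e) B = diag_fun k ?g * B"
    using entries by (intro scale_cols_eq_diag_fun_mult[OF B(1)]) simp
  moreover have "det (diag_fun k ?g) \<noteq> 0"
  proof -
    have "pick J r < n" if "r < k" for r using pick_in_set_le[of r J] that J by auto
    then show ?thesis using ev_nonzero div_less_p by (auto simp: det_diag_fun)
  qed
  moreover have "diag_fun k ?g * B * eig = diag_fun k ?g * (B * eig)"
    using B by (simp add: assoc_mult_mat[of _ k k B n eig n])
  ultimately show ?thesis
    using cyc_shift_mult_row_span[OF B(1), of e]
      row_span_mult_left[of "diag_fun k ?g" k "B * eig" n] B by simp
qed

lemma fixed_imp_stratum:
  assumes W: "W \<in> Gr k n" and fixed: "(cyc_shift k n ^^ (q * e)) W = W"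
    and inj: "inj_on (\<lambda>i. ev i ^ e) {..<p}"
  shows "\<exists>m. length m = p \<and> set m \<subseteq> {0..q} \<and> sum_list m = k \<and> W \<in> stratum m"
proof -
  obtain B J where B: "B \<in> carrier_mat k n" "row_span n (B * eig) = W" and J: "plucker_coord B J \<noteq> 0"
    using Gr_eig_obtain[OF W] by blast
  let ?d = "\<lambda>c. ev (c div q) ^ e"
  have carr: "scale_cols ?d B \<in> carrier_mat k n" "B * eig \<in> carrier_mat k n"
    "scale_cols ?d B * eig \<in> carrier_mat k n"
    using B(1) mult_carrier_mat[OF scale_cols_carrier[OF B(1)] eig_carrier(1)] by simp_all
  have "row_span n (scale_cols ?d B * eig) = row_span n (B * eig)"
    using fixed cyc_shift_mult_row_span[OF B(1), of e] B(2) by simp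
  then obtain G where G: "G \<in> carrier_mat k k" "scale_cols ?d B * eig = G * (B * eig)"
    using row_span_subset_imp_mult[OF carr(2,3)] by auto
  have "scale_cols ?d B = G * (B * eig) * eig_inv" using G(2)[symmetric] carr(1) by simp
  also have "\<dots> = G * B"
    using G(1) B(1) carr(2) by (simp add: assoc_mult_mat[of G k k "B * eig" n eig_inv n])
  finally have stab: "scale_cols ?d B = G * B" .
  have same: "card (slice q J' i) = card (slice q J i)"
    if J': "plucker_coord B J' \<noteq> 0" and i: "i < p" for J' i
  proof -
    let ?s = "\<lambda>c. if c div q = i then 2 else 1 :: complex"
    obtain H where H: "H \<in> carrier_mat k k" "scale_cols ?s B = H * B"
      using stabilized_indicator[OF _ G(1) stab inj i] B(1) n by blast
    \<comment> \<open>The left side is the factor by which \<open>?s\<close> scales the coordinate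
      at \<open>I\<close>; the right side does not depend on \<open>I\<close>.\<close>
    have "2 ^ card (slice q I i) = det H" if I: "plucker_coord B I \<noteq> 0" for I
    proof -
      have In: "I \<subseteq> {..<n}"
        using I plucker_coord_outside[OF B(1), of I] by (auto simp: ksubsets_def)
      have "(\<Prod>j\<in>I. ?s j) * plucker_coord B I = det H * plucker_coord B I"
        unfolding plucker_coord_scale_cols[OF B(1), symmetric]
          plucker_coord_mult_left[OF H(1) B(1), symmetric] H(2) ..
      then have "(\<Prod>j\<in>I. ?s j) = det H" using I by simp
      moreover have "(\<Prod>j\<in>I. ?s j) = (\<Prod>j | j \<in> I \<and> j div q = i. 2)"
        using In by (intro prod.mono_neutral_cong_right) (auto intro: finite_subset)
      moreover have "card {j. j \<in> I \<and> j div q = i} = card (slice q I i)"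
      proof (rule bij_betw_same_card[of "\<lambda>j. j mod q"], rule bij_betwI')
        show "x mod q = y mod q \<longleftrightarrow> x = y"
          if "x \<in> {j. j \<in> I \<and> j div q = i}" "y \<in> {j. j \<in> I \<and> j div q = i}" for x y
          using that by (metis (mono_tags, lifting) div_mult_mod_eq mem_Collect_eq)
        show "x mod q \<in> slice q I i" if "x \<in> {j. j \<in> I \<and> j div q = i}" for x
          using that q by (auto simp: slice_def)
        show "\<exists>x\<in>{j. j \<in> I \<and> j div q = i}. y = x mod q" if "y \<in> slice q I i" for y
          using that by (intro bexI[of _ "i * q + y"]) (auto simp: slice_def)
      qed
      ultimately show ?thesis by simp
    qed
    from this[OF J'] this[OF J] have "(2 :: complex) ^ card (slice q J' i) = 2 ^ card (slice q J i)"
      by simp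
    then have "cmod (2 ^ card (slice q J' i)) = cmod (2 ^ card (slice q J i))" by simp
    then show ?thesis by (simp add: norm_power)
  qed
  define m where "m = map (\<lambda>i. card (slice q J i)) [0..<p]"
  have "has_type m J'" if "plucker_coord B J' \<noteq> 0" for J'
    using same[OF that] by (simp add: has_type_def m_def)
  then have "W \<in> stratum m" using stratum_iff[OF B(1) J] B(2) by blast
  moreover have "card (slice q J i) \<le> q" for i
    using card_mono[OF _ slice_subset[of q J i]] by simp
  then have "set m \<subseteq> {0..q}" by (auto simp: m_def)
  moreover have "sum_list m = k"
  proof -
    have "J \<subseteq> {..<p * q}" "card J = k"
      using J plucker_coord_outside[OF B(1), of J] n by (auto simp: ksubsets_def)
    then show ?thesis
      using card_eq_sum_slices[of J p q] by (simp add: m_def sum_list_sum_nth atLeast0LessThan)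
  qed
  ultimately show ?thesis by (intro exI[of _ m]) (simp add: m_def)
qed

text \<open>These coefficients express the coordinates in the eigenbasis as linear forms in the
  original Pluecker coordinates, in which the Zariski topology is defined.\<close>

definition eig_coeff :: "nat set \<Rightarrow> nat set \<Rightarrow> complex" where
  "eig_coeff = (SOME C. \<forall>A\<in>carrier_mat k n. \<forall>J.
     plucker_coord (A * eig_inv) J = (\<Sum>I\<in>ksubsets k n. C J I * plucker_coord A I))"

definition eig_coord :: "(nat set \<Rightarrow> complex) \<Rightarrow> nat set \<Rightarrow> complex" where
  "eig_coord z J = (\<Sum>I\<in>ksubsets k n. eig_coeff J I * z I)"

lemma eig_coord_scale: "eig_coord (\<lambda>I. c * z I) J = c * eig_coord z J"
  by (simp add: eig_coord_def sum_distrib_left algebra_simps)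

lemma eig_coord_plucker_coord:
  assumes B: "B \<in> carrier_mat k n"
  shows "eig_coord (plucker_coord (B * eig)) J = plucker_coord B J"
proof -
  have coeff: "\<forall>A\<in>carrier_mat k n. \<forall>J. plucker_coord (A * eig_inv) J =
      (\<Sum>I\<in>ksubsets k n. eig_coeff J I * plucker_coord A I)"
    unfolding eig_coeff_def by (rule someI_ex[OF plucker_coord_mult_right[OF eig_carrier(2)]])
  have "B * eig \<in> carrier_mat k n" using B by simp
  from bspec[OF coeff this, rule_format, of J] show ?thesis
    unfolding mult_inv_eig[OF B] eig_coord_def by (rule sym)
qed

lemma multiform_eig_coord: "multiform ((\<lambda>_. 0)(0 := 1)) (\<lambda>z. eig_coord (z 0) J)"
  unfolding eig_coord_def
  using multiform_scale[OF multiform.coord[of 0], of 0 "{}"]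
  by (intro multiform_sum multiform_scale multiform.coord) simp_all

lemma plucker_eig:
  assumes "B \<in> carrier_mat k n" "plucker_coord B J \<noteq> 0"
  shows "plucker k n (row_span n (B * eig)) = proj_pt (plucker_coord (B * eig))"
  using assms by (intro plucker_row_span(1)[OF _ refl Gr_eig_I]) simp_all

lemma plucker_eig_coord:
  assumes "B \<in> carrier_mat k n" "plucker_coord B J0 \<noteq> 0"
    and "z \<in> plucker k n (row_span n (B * eig))"
  obtains c where "c \<noteq> 0" "\<And>J. eig_coord z J = c * plucker_coord B J"
  using assms(3) unfolding plucker_eig[OF assms(1,2)] proj_pt_def
  by (auto simp: eig_coord_scale eig_coord_plucker_coord[OF assms(1)])

lemma stratum_iff_eig_coord:
  assumes W: "W \<in> Gr k n" and z: "z \<in> plucker k n W"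
  shows "W \<in> stratum m \<longleftrightarrow> (\<forall>J. eig_coord z J \<noteq> 0 \<longrightarrow> has_type m J)"
proof -
  obtain B J where B: "B \<in> carrier_mat k n" "row_span n (B * eig) = W" "plucker_coord B J \<noteq> 0"
    using Gr_eig_obtain[OF W] by blast
  then obtain c where "c \<noteq> 0" "\<And>J. eig_coord z J = c * plucker_coord B J"
    using plucker_eig_coord z by metis
  then show ?thesis using stratum_iff[OF B(1,3)] B(2) by simp
qed

lemma plucker_Gr_obtain:
  assumes "W \<in> Gr k n"
  obtains z J where "plucker k n W = proj_pt z" "eig_coord z J \<noteq> 0"
proof -
  obtain B J where B: "B \<in> carrier_mat k n" "row_span n (B * eig) = W" "plucker_coord B J \<noteq> 0"
    using Gr_eig_obtain[OF assms] by blast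
  then show thesis
    using that[of "plucker_coord (B * eig)" J] plucker_eig eig_coord_plucker_coord by auto
qed

lemma proj_lists_plucker_Gr: "proj_lists (listset [plucker k n ` Gr k n])"
  unfolding proj_lists_def listset_singleton by (auto elim!: plucker_Gr_obtain)

text \<open>The complement is the union of the nonvanishing loci of the linear forms
  \<open>eig_coord\<close> at the sets \<open>J\<close> that are not of type
  \<open>m\<close>.\<close>

lemma closedin_stratum:
  "closedin (zariski (listset [plucker k n ` Gr k n])) (listset [plucker k n ` stratum m])"
proof -
  let ?V = "listset [plucker k n ` Gr k n]" and ?S = "listset [plucker k n ` stratum m]"
  let ?F = "{\<lambda>z. eig_coord (z 0) J | J. \<not> has_type m J} :: ((nat \<Rightarrow> nat set \<Rightarrow> complex) \<Rightarrow> complex) set"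
  have mem: "[plucker k n W] \<in> {x \<in> ?V. \<exists>f\<in>?F. \<forall>z\<in>hcoords x. f z \<noteq> 0} \<longleftrightarrow> W \<notin> stratum m"
    if W: "W \<in> Gr k n" for W
  proof -
    have V: "[plucker k n W] \<in> ?V" using W by (simp add: listset_singleton)
    then obtain z where z: "z \<in> hcoords [plucker k n W]"
      using hcoords_nonempty[OF proj_lists_plucker_Gr] by blast
    then have z0: "z 0 \<in> plucker k n W" by (simp add: hcoords_singleton)
    have "(\<forall>w\<in>hcoords [plucker k n W]. eig_coord (w 0) J \<noteq> 0) \<longleftrightarrow> eig_coord (z 0) J \<noteq> 0" for J
      using hcoords_nonzero_iff[OF proj_lists_plucker_Gr V _ z multiform_eig_coord] z by blast
    then show ?thesis using V stratum_iff_eig_coord[OF W z0, of m] by auto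
  qed
  \<comment> \<open>By \<open>mem\<close>, membership in the stratum depends only on the point, so a
    subspace outside the stratum cannot have its point in the image of the stratum.\<close>
  have same: "W \<in> stratum m" if W: "W \<in> Gr k n" and x: "[plucker k n W] \<in> ?S" for W
  proof -
    obtain W' where W': "W' \<in> stratum m" "plucker k n W = plucker k n W'"
      using x by (auto simp: listset_singleton)
    then show ?thesis using mem[of W'] mem[OF W] stratum_subset_Gr[of m] by (simp only: subset_iff) blast
  qed
  have "?V - ?S = {x \<in> ?V. \<exists>f\<in>?F. \<forall>z\<in>hcoords x. f z \<noteq> 0}" (is "_ = ?O")
  proof (rule Set.set_eqI)
    fix x
    show "x \<in> ?V - ?S \<longleftrightarrow> x \<in> ?O"
    proof (cases "x \<in> ?V")
      case True
      then obtain W where W: "W \<in> Gr k n" "x = [plucker k n W]"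
        unfolding listset_singleton by blast
      have "x \<in> ?S \<longleftrightarrow> W \<in> stratum m"
        using same[OF W(1)] unfolding W(2) by (auto simp: listset_singleton)
      moreover have "x \<in> ?O \<longleftrightarrow> W \<notin> stratum m" unfolding W(2) by (rule mem[OF W(1)])
      ultimately show ?thesis using True by simp
    qed simp
  qed
  moreover have "\<forall>f\<in>?F. \<exists>d. multiform d f" using multiform_eig_coord by blast
  ultimately have "openin (zariski ?V) (?V - ?S)"
    unfolding openin_zariski by (intro exI[of _ ?F] conjI)
  moreover have "?S \<subseteq> ?V" unfolding listset_singleton using stratum_subset_Gr by auto
  ultimately show ?thesis by (simp add: closedin_def)
qed

section \<open>A stratum is a product of Grassmannians\<close>

definition glue :: "(nat \<Rightarrow> nat set) \<Rightarrow> nat set" where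
  "glue f = {c. c < n \<and> c mod q \<in> f (c div q)}"

lemma glue_subset: "glue f \<subseteq> {..<p * q}"
  unfolding n[symmetric] by (auto simp: glue_def)

lemma slice_glue:
  assumes "i < p" "f i \<subseteq> {..<q}"
  shows "slice q (glue f) i = f i"
proof -
  have "i * q + a < n" if "a < q" for a
  proof -
    have "i * q + a < Suc i * q" using that by simp
    also have "\<dots> \<le> n" unfolding n using assms(1) by (intro mult_right_mono) auto
    finally show ?thesis .
  qed
  then show ?thesis using assms(2) by (auto simp: slice_def glue_def)
qed

definition blocks :: "nat list \<Rightarrow> nat set proj list \<Rightarrow> complex mat list \<Rightarrow> bool" where
  "blocks m xs As \<longleftrightarrow> length As = p \<and> (\<forall>i<p. As ! i \<in> carrier_mat (m ! i) q \<and>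
     (\<exists>I. plucker_coord (As ! i) I \<noteq> 0) \<and> xs ! i = proj_pt (plucker_coord (As ! i)))"

lemma listset_plucker_iff:
  assumes "length m = p"
  shows "xs \<in> listset (map (\<lambda>r. plucker r q ` Gr r q) m) \<longleftrightarrow>
    length xs = p \<and> (\<exists>As. blocks m xs As)"
proof
  assume "xs \<in> listset (map (\<lambda>r. plucker r q ` Gr r q) m)"
  then have xs: "length xs = p" "\<And>i. i < p \<Longrightarrow> xs ! i \<in> plucker (m ! i) q ` Gr (m ! i) q"
    using assms by (auto simp: mem_listset_iff)
  have "\<exists>A. A \<in> carrier_mat (m ! i) q \<and> (\<exists>I. plucker_coord A I \<noteq> 0) \<and>
      xs ! i = proj_pt (plucker_coord A)" if i: "i < p" for i
  proof -
    obtain W where W: "W \<in> Gr (m ! i) q" "xs ! i = plucker (m ! i) q W" using xs(2)[OF i] by blast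
    obtain A where A: "A \<in> carrier_mat (m ! i) q" "row_span q A = W" "\<exists>I. plucker_coord A I \<noteq> 0"
      using Gr_obtain[OF W(1)] by blast
    then show ?thesis using plucker_row_span(1)[OF A(1,2) W(1)] W(2) by blast
  qed
  then obtain A where "\<And>i. i < p \<Longrightarrow> A i \<in> carrier_mat (m ! i) q \<and>
      (\<exists>I. plucker_coord (A i) I \<noteq> 0) \<and> xs ! i = proj_pt (plucker_coord (A i))" by metis
  then have "blocks m xs (map A [0..<p])" by (simp add: blocks_def)
  then show "length xs = p \<and> (\<exists>As. blocks m xs As)" using xs(1) by blast
next
  assume "length xs = p \<and> (\<exists>As. blocks m xs As)"
  then obtain As where len: "length xs = p" and As: "blocks m xs As" by blast
  have "xs ! i \<in> plucker (m ! i) q ` Gr (m ! i) q" if i: "i < p" for i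
  proof -
    obtain I where A: "As ! i \<in> carrier_mat (m ! i) q" "plucker_coord (As ! i) I \<noteq> 0"
      "xs ! i = proj_pt (plucker_coord (As ! i))" using As i unfolding blocks_def by blast
    have "row_span q (As ! i) \<in> Gr (m ! i) q" by (rule Gr_I[OF A(1,2)])
    then show ?thesis using plucker_row_span(1)[OF A(1) refl] A(3) by (intro image_eqI) auto
  qed
  then show "xs \<in> listset (map (\<lambda>r. plucker r q ` Gr r q) m)"
    using len assms by (simp add: mem_listset_iff)
qed

context
  fixes m :: "nat list"
  assumes len: "length m = p" and sum: "sum_list m = k"
begin

lemma blocks_carrier:
  assumes "blocks m xs As"
  shows "diag_block_mat As \<in> carrier_mat k n"
  using diag_block_mat_carrier[of As m q] assms len sum n by (simp add: blocks_def)

lemma blocks_plucker_coord: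
  assumes "blocks m xs As" "J \<in> ksubsets k n"
  shows "plucker_coord (diag_block_mat As) J = (\<Prod>i<p. plucker_coord (As ! i) (slice q J i))"
  using plucker_coord_diag_block_mat[of As m q J] assms len sum n by (simp add: blocks_def)

lemma glue_ksubset:
  assumes "\<And>i. i < p \<Longrightarrow> f i \<in> ksubsets (m ! i) q"
  shows "glue f \<in> ksubsets k n"
proof -
  have "card (glue f) = (\<Sum>i<p. card (slice q (glue f) i))"
    by (rule card_eq_sum_slices[OF glue_subset])
  also have "\<dots> = (\<Sum>i<p. m ! i)"
    using assms by (intro sum.cong) (auto simp: ksubsets_def slice_glue)
  also have "\<dots> = k" using len sum by (simp add: sum_list_sum_nth atLeast0LessThan)
  finally show ?thesis using glue_subset n by (simp add: ksubsets_def)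
qed

text \<open>Nonvanishing coordinates of the single blocks are glued to one of the block diagonal
  matrix.\<close>

lemma blocks_nonzero:
  assumes As: "blocks m xs As"
  shows "\<exists>J. plucker_coord (diag_block_mat As) J \<noteq> 0"
proof -
  obtain I where I: "\<And>i. i < p \<Longrightarrow> plucker_coord (As ! i) (I i) \<noteq> 0"
    using As unfolding blocks_def by metis
  have Ik: "I i \<in> ksubsets (m ! i) q" if "i < p" for i
    using plucker_coord_outside[of "As ! i" "m ! i" q "I i"] I[OF that] As that
    unfolding blocks_def by blast
  have K: "glue I \<in> ksubsets k n" by (rule glue_ksubset) (rule Ik)
  have sl: "slice q (glue I) i = I i" if "i < p" for i
    using Ik[OF that] that by (intro slice_glue) (auto simp: ksubsets_def)
  have "plucker_coord (diag_block_mat As) (glue I) = (\<Prod>i<p. plucker_coord (As ! i) (I i))"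
    unfolding blocks_plucker_coord[OF As K] by (intro prod.cong refl) (simp add: sl)
  then show ?thesis using I by (intro exI[of _ "glue I"]) simp
qed

lemma blocks_type:
  assumes As: "blocks m xs As" and J: "plucker_coord (diag_block_mat As) J \<noteq> 0"
  shows "J \<in> ksubsets k n" and "\<And>i. i < p \<Longrightarrow> slice q J i \<in> ksubsets (m ! i) q"
    and "\<And>i. i < p \<Longrightarrow> plucker_coord (As ! i) (slice q J i) \<noteq> 0"
proof -
  show Jk: "J \<in> ksubsets k n" using plucker_coord_outside[OF blocks_carrier[OF As]] J by blast
  show nz: "plucker_coord (As ! i) (slice q J i) \<noteq> 0" if "i < p" for i
    using J that unfolding blocks_plucker_coord[OF As Jk] by auto
  show "slice q J i \<in> ksubsets (m ! i) q" if "i < p" for i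
    using plucker_coord_outside[of "As ! i" "m ! i" q "slice q J i"] nz[OF that] As that
    unfolding blocks_def by blast
qed

lemma blocks_stratum:
  assumes As: "blocks m xs As"
  shows "row_span n (diag_block_mat As * eig) \<in> stratum m"
proof -
  have "has_type m J" if "plucker_coord (diag_block_mat As) J \<noteq> 0" for J
    using blocks_type(2)[OF As that] by (simp add: has_type_def ksubsets_def)
  then show ?thesis using blocks_nonzero[OF As] stratum_iff[OF blocks_carrier[OF As]] by blast
qed

lemma stratum_blocks:
  assumes W: "W \<in> stratum m"
  obtains xs As where "length xs = p" "blocks m xs As" "W = row_span n (diag_block_mat As * eig)"
proof -
  obtain B J where B: "B \<in> carrier_mat k n" "row_span n (B * eig) = W" "plucker_coord B J \<noteq> 0"
    and entries: "\<And>r c. r < k \<Longrightarrow> c < n \<Longrightarrow> B $$ (r, c) \<noteq> 0 \<Longrightarrow> c div q = pick J r div q"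
    using stratum_normal_form[OF W] by blast
  have "has_type m J" using stratum_iff[OF B(1,3)] B(2,3) W by blast
  moreover have Jk: "J \<in> ksubsets k n" using plucker_coord_outside[OF B(1)] B(3) by blast
  ultimately have "\<exists>As. length As = length m \<and> (\<forall>i<length m. As ! i \<in> carrier_mat (m ! i) q) \<and>
      B = diag_block_mat As"
    using B(1) entries q len sum n
    by (intro block_entries_imp_diag_block_mat[of q B m J]) (auto simp: has_type_def)
  then obtain As where As: "length As = p" "\<And>i. i < p \<Longrightarrow> As ! i \<in> carrier_mat (m ! i) q"
    "B = diag_block_mat As" using len by auto
  \<comment> \<open>Each factor of the nonzero product is nonzero, so every block has full
    rank.\<close>
  have "plucker_coord B J = (\<Prod>i<p. plucker_coord (As ! i) (slice q J i))"
    using plucker_coord_diag_block_mat[of As m q J] As Jk len sum n by simp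
  then have "\<exists>I. plucker_coord (As ! i) I \<noteq> 0" if "i < p" for i using B(3) that by auto
  then have "blocks m (map (\<lambda>A. proj_pt (plucker_coord A)) As) As"
    using As by (simp add: blocks_def)
  then show thesis using that[of "map (\<lambda>A. proj_pt (plucker_coord A)) As" As] As B(2) by simp
qed

text \<open>Independence of the chosen matrices follows from \<open>ex_join_form\<close>, whose
  \<open>F z\<close> depends only on the coordinates of \<open>xs\<close>.\<close>

definition join :: "nat set proj list \<Rightarrow> nat set proj list" where
  "join xs = [plucker k n (row_span n (diag_block_mat (SOME As. blocks m xs As) * eig))]"

text \<open>The guard \<open>I \<subseteq> {..<q}\<close> matters because \<open>glue\<close> sees
  only the part of \<open>I\<close> below \<open>q\<close>, whereas the coordinates of a factor
  vanish at sets that are not contained in \<open>{..<q}\<close>.\<close>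

definition split :: "nat set \<Rightarrow> (nat \<Rightarrow> nat set \<Rightarrow> complex) \<Rightarrow> nat \<Rightarrow> nat set \<Rightarrow> complex" where
  "split J z i I =
     (if i < p \<and> I \<subseteq> {..<q} then eig_coord (z 0) (glue ((slice q J)(i := I))) else 0)"

text \<open>The coordinate at a glued set is the product of the coordinates of the blocks. Only the
  factor of block \<open>i\<close> varies with \<open>I\<close>; the others form a constant, nonzero
  because the coordinate at \<open>J\<close> is.\<close>

lemma split_hcoords:
  assumes As: "blocks m xs As" and xs: "length xs = p"
    and z: "z \<in> hcoords [plucker k n (row_span n (diag_block_mat As * eig))]"
    and J: "eig_coord (z 0) J \<noteq> 0"
  shows "split J z \<in> hcoords xs"
proof -
  let ?B = "diag_block_mat As"
  have B: "?B \<in> carrier_mat k n" by (rule blocks_carrier[OF As])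
  obtain J0 where J0: "plucker_coord ?B J0 \<noteq> 0" using blocks_nonzero[OF As] by blast
  obtain c where c: "c \<noteq> 0" "\<And>J. eig_coord (z 0) J = c * plucker_coord ?B J"
    using plucker_eig_coord[OF B J0] z unfolding hcoords_singleton by blast
  have BJ: "plucker_coord ?B J \<noteq> 0" using J c by auto
  note type = blocks_type[OF As BJ]
  have "split J z i \<in> xs ! i" if i: "i < p" for i
  proof -
    have Ai: "As ! i \<in> carrier_mat (m ! i) q" "xs ! i = proj_pt (plucker_coord (As ! i))"
      using As i by (auto simp: blocks_def)
    let ?c = "c * (\<Prod>j\<in>{..<p} - {i}. plucker_coord (As ! j) (slice q J j))"
    have "split J z i I = ?c * plucker_coord (As ! i) I" for I
    proof (cases "I \<in> ksubsets (m ! i) q")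
      case True
      let ?f = "(slice q J)(i := I)"
      have f: "?f j \<in> ksubsets (m ! j) q" if "j < p" for j using True type(2) that by simp
      have K: "glue ?f \<in> ksubsets k n" by (rule glue_ksubset) (rule f)
      have sl: "slice q (glue ?f) j = ?f j" if "j < p" for j
        using f[OF that] that by (intro slice_glue) (simp_all add: ksubsets_def)
      have "plucker_coord ?B (glue ?f) = (\<Prod>j<p. plucker_coord (As ! j) (?f j))"
        unfolding blocks_plucker_coord[OF As K]
        by (intro prod.cong refl) (simp add: sl del: fun_upd_apply)
      also have "\<dots> = plucker_coord (As ! i) I *
          (\<Prod>j\<in>{..<p} - {i}. plucker_coord (As ! j) (slice q J j))"
        using i by (subst prod.remove[of _ i]) auto
      finally show ?thesis using True i by (simp add: split_def c ksubsets_def)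
    next
      case False
      have "plucker_coord ?B (glue ((slice q J)(i := I))) = 0" if I: "I \<subseteq> {..<q}"
      proof (rule ccontr)
        assume "\<not> ?thesis"
        then have "slice q (glue ((slice q J)(i := I))) i \<in> ksubsets (m ! i) q"
          using blocks_type(2)[OF As _ i] by blast
        then show False using False I slice_glue[OF i, of "(slice q J)(i := I)"] by simp
      qed
      then show ?thesis
        using plucker_coord_outside[OF Ai(1) False] by (simp add: split_def c)
    qed
    moreover have "?c \<noteq> 0" using c(1) type(3) by simp
    ultimately show ?thesis unfolding Ai(2) proj_pt_def by blast
  qed
  moreover have "split J z i = (\<lambda>_. 0)" if "p \<le> i" for i
    using that by (auto simp: split_def)
  ultimately show ?thesis unfolding hcoords_def xs by blast
qed

lemma multiform_split:
  "multiform (if i < p then (\<lambda>_. 0)(0 := 1) else (\<lambda>_. 0)) (\<lambda>z. split J z i I)"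
proof -
  have "multiform ((\<lambda>_. 0)(0 := 1)) (\<lambda>z :: nat \<Rightarrow> nat set \<Rightarrow> complex. 0)"
    using multiform_scale[OF multiform.coord[of 0], of 0 "{}"] by simp
  then show ?thesis
    unfolding split_def
    by (cases "i < p"; cases "I \<subseteq> {..<q}") (simp_all add: multiform_eig_coord multiform.const del: One_nat_def)
qed

text \<open>The forms are those of a Segre map, products of one coordinate from each factor,
  followed by the linear change of coordinates that belongs to \<open>eig\<close>.\<close>

lemma ex_join_form:
  "\<exists>D F. (\<forall>i v. multiform (D i) (\<lambda>z. F z i v)) \<and> (\<forall>i\<ge>1. D i = (\<lambda>_. 0)) \<and>
    (\<forall>xs As z. blocks m xs As \<longrightarrow> length xs = p \<longrightarrow> z \<in> hcoords xs \<longrightarrow>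
      F z \<in> hcoords [plucker k n (row_span n (diag_block_mat As * eig))])"
proof -
  obtain C where C: "\<And>B J. B \<in> carrier_mat k n \<Longrightarrow>
      plucker_coord (B * eig) J = (\<Sum>I\<in>ksubsets k n. C J I * plucker_coord B I)"
    using plucker_coord_mult_right[OF eig_carrier(1), of k] by blast
  \<comment> \<open>Degree one in each of the first \<open>p\<close> blocks, written as a sum to
    match \<open>multiform_prod\<close>.\<close>
  let ?d = "\<lambda>j. \<Sum>s<p. ((\<lambda>_. 0)(s := 1)) j :: nat"
  define D where "D i = (if i = 0 then ?d else (\<lambda>_. 0))" for i :: nat
  define F :: "(nat \<Rightarrow> nat set \<Rightarrow> complex) \<Rightarrow> nat \<Rightarrow> nat set \<Rightarrow> complex" where
    "F z i J = (if i = 0 then \<Sum>I\<in>ksubsets k n. C J I * (\<Prod>s<p. z s (slice q I s)) else 0)" for z i J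
  have prod: "multiform ?d (\<lambda>z. \<Prod>s<p. z s (slice q I s))" for I
    by (intro multiform_prod multiform.coord) simp
  have zero: "multiform ?d (\<lambda>z :: nat \<Rightarrow> nat set \<Rightarrow> complex. 0)"
    using multiform_scale[OF prod, of 0] by simp
  have "multiform ?d (\<lambda>z. \<Sum>I\<in>ksubsets k n. C J I * (\<Prod>s<p. z s (slice q I s)))" for J
    by (intro multiform_sum zero multiform_scale prod) simp
  then have "multiform (D i) (\<lambda>z. F z i J)" for i J
    by (cases "i = 0") (simp_all add: D_def F_def multiform.const del: One_nat_def)
  moreover have "F z \<in> hcoords [plucker k n (row_span n (diag_block_mat As * eig))]"
    if As: "blocks m xs As" and xs: "length xs = p" and z: "z \<in> hcoords xs" for xs As z
  proof -
    let ?B = "diag_block_mat As"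
    have B: "?B \<in> carrier_mat k n" by (rule blocks_carrier[OF As])
    obtain J0 where J0: "plucker_coord ?B J0 \<noteq> 0" using blocks_nonzero[OF As] by blast
    have "\<exists>c. c \<noteq> 0 \<and> z i = (\<lambda>I. c * plucker_coord (As ! i) I)" if "i < p" for i
    proof -
      have "z i \<in> proj_pt (plucker_coord (As ! i))"
        using z As that xs by (auto simp: hcoords_def blocks_def)
      then show ?thesis unfolding proj_pt_def by blast
    qed
    then obtain c where c: "\<And>i. i < p \<Longrightarrow> c i \<noteq> 0"
      "\<And>i. i < p \<Longrightarrow> z i = (\<lambda>I. c i * plucker_coord (As ! i) I)" by metis
    have "(\<Prod>s<p. z s (slice q I s)) = (\<Prod>s<p. c s) * plucker_coord ?B I" if "I \<in> ksubsets k n" for I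
      unfolding blocks_plucker_coord[OF As that] prod.distrib[symmetric]
      using c(2) by (intro prod.cong) auto
    then have "F z 0 = (\<lambda>J. (\<Prod>s<p. c s) * plucker_coord (?B * eig) J)"
      unfolding C[OF B] F_def by (auto simp: sum_distrib_left algebra_simps intro!: sum.cong)
    moreover have "(\<Prod>s<p. c s) \<noteq> 0" using c(1) by simp
    ultimately have "F z 0 \<in> plucker k n (row_span n (?B * eig))"
      unfolding plucker_eig[OF B J0] proj_pt_def by blast
    then show ?thesis by (auto simp: hcoords_singleton F_def)
  qed
  moreover have "\<forall>i\<ge>1. D i = (\<lambda>_. 0)" by (simp add: D_def)
  ultimately show ?thesis by blast
qed

text \<open>The inverse of \<open>join\<close> is first obtained as a map of sets; locally it is
  given by \<open>split J\<close>, where \<open>J\<close> is any set whose coordinate is nonzero at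
  the point considered.\<close>

lemma variety_isomorphic_stratum:
  "variety_isomorphic (listset [plucker k n ` stratum m])
    (listset (map (\<lambda>r. plucker r q ` Gr r q) m))"
proof -
  let ?V = "listset [plucker k n ` stratum m]"
    and ?W = "listset (map (\<lambda>r. plucker r q ` Gr r q) m)"
  have "?V \<subseteq> listset [plucker k n ` Gr k n]"
    unfolding listset_singleton using stratum_subset_Gr by blast
  then have V: "proj_lists ?V" using proj_lists_subset[OF proj_lists_plucker_Gr] by blast
  have W: "proj_lists ?W"
    unfolding proj_lists_def
  proof (intro ballI)
    fix xs P assume xs: "xs \<in> ?W" and P: "P \<in> set xs"
    obtain As where As: "length xs = p" "blocks m xs As"
      using xs unfolding listset_plucker_iff[OF len] by blast
    obtain i where "i < p" "P = xs ! i" using P As(1) by (metis in_set_conv_nth)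
    then show "\<exists>z. P = proj_pt z" using As(2) unfolding blocks_def by blast
  qed
  have join: "\<exists>As. blocks m xs As \<and>
      join xs = [plucker k n (row_span n (diag_block_mat As * eig))]" if "xs \<in> ?W" for xs
  proof -
    have "\<exists>As. blocks m xs As" using that by (simp add: listset_plucker_iff[OF len])
    then have "blocks m xs (SOME As. blocks m xs As)" by (rule someI_ex)
    then show ?thesis unfolding join_def by blast
  qed
  have join_V: "join xs \<in> ?V" if "xs \<in> ?W" for xs
    using join[OF that] blocks_stratum by (auto simp: listset_singleton)
  have split: "split J z \<in> hcoords xs"
    if xs: "xs \<in> ?W" and z: "z \<in> hcoords (join xs)" "eig_coord (z 0) J \<noteq> 0" for xs z J
  proof -
    obtain As where As: "blocks m xs As"
      "join xs = [plucker k n (row_span n (diag_block_mat As * eig))]" using join[OF xs] by blast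
    have "length xs = p" using xs by (simp add: listset_plucker_iff[OF len])
    then show ?thesis using split_hcoords[OF As(1)] z unfolding As(2) by blast
  qed
  have coord: "\<exists>z\<in>hcoords y. \<exists>J. eig_coord (z 0) J \<noteq> 0" if y: "y \<in> ?V" for y
  proof -
    obtain W where W: "W \<in> Gr k n" "y = [plucker k n W]"
      using y stratum_subset_Gr unfolding listset_singleton by blast
    obtain z J where z: "plucker k n W = proj_pt z" "eig_coord z J \<noteq> 0"
      using plucker_Gr_obtain[OF W(1)] by blast
    then have "(\<lambda>i. if i = 0 then z else (\<lambda>_. 0)) \<in> hcoords y"
      using proj_pt_self by (simp add: W(2) hcoords_singleton)
    then show ?thesis using z(2) by (intro bexI exI[of _ J]) simp_all
  qed
  have inj: "inj_on join ?W"
  proof (rule inj_onI)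
    fix xs xs' assume xs: "xs \<in> ?W" "xs' \<in> ?W" and eq: "join xs = join xs'"
    obtain z J where "z \<in> hcoords (join xs)" "eig_coord (z 0) J \<noteq> 0"
      using coord[OF join_V[OF xs(1)]] by blast
    \<comment> \<open>One vector gives coordinates of both \<open>xs\<close> and \<open>xs'\<close>,
      and a scaling orbit is determined by any of its elements.\<close>
    then have w: "split J z \<in> hcoords xs" "split J z \<in> hcoords xs'"
      using split xs eq by simp_all
    have l: "length xs = p" "length xs' = p" using xs by (simp_all add: listset_plucker_iff[OF len])
    show "xs = xs'"
    proof (rule nth_equalityI)
      fix i assume "i < length xs"
      then have i: "i < p" using l by simp
      then have mem: "xs ! i \<in> set xs" "xs' ! i \<in> set xs'" using l by simp_all
      obtain u where u: "xs ! i = proj_pt u"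
        using W[unfolded proj_lists_def, rule_format, OF xs(1) mem(1)] by blast
      obtain u' where u': "xs' ! i = proj_pt u'"
        using W[unfolded proj_lists_def, rule_format, OF xs(2) mem(2)] by blast
      have "split J z i \<in> xs ! i" "split J z i \<in> xs' ! i"
        using w i l by (simp_all add: hcoords_def)
      then show "xs ! i = xs' ! i"
        unfolding u u' using proj_pt_eqI[of "split J z i" u] proj_pt_eqI[of "split J z i" u'] by simp
    qed (use l in simp)
  qed
  have surj: "join ` ?W = ?V"
  proof (intro equalityI subsetI)
    fix y assume "y \<in> ?V"
    then obtain W where W: "W \<in> stratum m" "y = [plucker k n W]"
      unfolding listset_singleton by blast
    obtain xs As where As: "length xs = p" "blocks m xs As" "W = row_span n (diag_block_mat As * eig)"
      using stratum_blocks[OF W(1)] by blast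
    then have xs: "xs \<in> ?W" using listset_plucker_iff[OF len] by blast
    obtain As' where As': "blocks m xs As'"
      "join xs = [plucker k n (row_span n (diag_block_mat As' * eig))]" using join[OF xs] by blast
    obtain F where F: "\<And>As z. blocks m xs As \<Longrightarrow> z \<in> hcoords xs \<Longrightarrow>
        F z \<in> hcoords [plucker k n (row_span n (diag_block_mat As * eig))]"
      using ex_join_form As(1) by blast
    obtain z where "z \<in> hcoords xs" using hcoords_nonempty[OF \<open>proj_lists ?W\<close> xs] by blast
    \<comment> \<open>\<open>As\<close> comes from \<open>W\<close> and \<open>As'\<close> from the
      choice in \<open>join\<close>; the vector \<open>F z 0\<close> lies in both points, which
      therefore coincide.\<close>
    then have Fz: "F z 0 \<in> plucker k n (row_span n (diag_block_mat As * eig))"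
      "F z 0 \<in> plucker k n (row_span n (diag_block_mat As' * eig))"
      using F As(2) As'(1) unfolding hcoords_singleton by blast+
    have "plucker k n (row_span n (diag_block_mat As * eig)) = proj_pt w"
      if "w \<in> plucker k n (row_span n (diag_block_mat As * eig))" and As: "blocks m xs As" for As w
    proof -
      have "row_span n (diag_block_mat As * eig) \<in> Gr k n"
        using blocks_stratum[OF As] stratum_subset_Gr by blast
      then obtain u where u: "plucker k n (row_span n (diag_block_mat As * eig)) = proj_pt u"
        using plucker_Gr_obtain by metis
      show ?thesis using proj_pt_eqI[of w u] that(1) unfolding u by simp
    qed
    from this[OF Fz(1) As(2)] this[OF Fz(2) As'(1)]
    have "plucker k n (row_span n (diag_block_mat As * eig)) =
        plucker k n (row_span n (diag_block_mat As' * eig))"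
      by simp
    then have "y = join xs" unfolding W(2) As(3) As'(2) by simp
    then show "y \<in> join ` ?W" using xs by blast
  qed (use join_V in blast)
  define sep where "sep = inv_into ?W join"
  have sep_W: "sep y \<in> ?W" and join_sep: "join (sep y) = y" if "y \<in> ?V" for y
    using that surj by (auto simp: sep_def inv_into_into f_inv_into_f)
  have sep_join: "sep (join xs) = xs" if "xs \<in> ?W" for xs
    unfolding sep_def by (rule inv_into_f_f[OF inj that])
  have "variety_morphism ?V ?W sep"
  proof (rule variety_morphism_local[where N = p, OF V W sep_W])
    fix y assume y: "y \<in> ?V"
    obtain z J where z: "z \<in> hcoords y" "eig_coord (z 0) J \<noteq> 0" using coord[OF y] by blast
    let ?f = "\<lambda>z. eig_coord (z 0) J"
    \<comment> \<open>On this neighbourhood of \<open>y\<close> the single set \<open>J\<close>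
      serves for all points.\<close>
    let ?U = "{y \<in> ?V. \<forall>z\<in>hcoords y. ?f z \<noteq> 0}"
    have "openin (zariski ?V) ?U" by (rule openin_zariski_form[OF multiform_eig_coord])
    moreover have "y \<in> ?U"
      using hcoords_nonzero_iff[OF V y z(1) _ multiform_eig_coord, of _ J] z(2) y by blast
    moreover have "split J w \<in> hcoords (sep y')" if "y' \<in> ?U" "w \<in> hcoords y'" for y' w
      using split[OF sep_W[of y'], of w J] that join_sep[of y'] by simp
    ultimately show "forms_near p ?V sep y"
      unfolding forms_near_def
      by (intro exI[of _ ?U] exI[of _ "\<lambda>i. if i < p then (\<lambda>_. 0)(0 := 1) else (\<lambda>_. 0)"]
          exI[of _ "split J"]) (simp add: multiform_split)
  qed
  moreover have "variety_morphism ?W ?V join"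
  proof (rule variety_morphism_local[where N = 1, OF W V join_V])
    fix xs assume xs: "xs \<in> ?W"
    obtain D F where D: "\<forall>i v. multiform (D i) (\<lambda>z. F z i v)" "\<forall>i\<ge>1. D i = (\<lambda>_. 0)"
      and F: "\<forall>xs As z. blocks m xs As \<longrightarrow> length xs = p \<longrightarrow> z \<in> hcoords xs \<longrightarrow>
        F z \<in> hcoords [plucker k n (row_span n (diag_block_mat As * eig))]"
      using ex_join_form by blast
    have "F z \<in> hcoords (join ys)" if ys: "ys \<in> ?W" "z \<in> hcoords ys" for ys z
    proof -
      have "length ys = p" using ys(1) by (simp add: listset_plucker_iff[OF len])
      then show ?thesis using join[OF ys(1)] F ys(2) by auto
    qed
    moreover have "openin (zariski ?W) ?W" using openin_topspace[of "zariski ?W"] by simp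
    ultimately show "forms_near 1 ?W join xs"
      unfolding forms_near_def using D xs by (intro exI[of _ ?W] exI[of _ D] exI[of _ F]) blast
  qed
  ultimately show ?thesis
    unfolding variety_isomorphic_def using join_sep sep_join by blast
qed

end

end

theorem proposition4p1:
  fixes k n l l' p :: nat
  assumes "1 \<le> k" and "k \<le> n" and "1 \<le> l"
    and "l' = gcd l n" and "p = n div l'"
  shows "\<exists>Y :: nat list \<Rightarrow> complex vec set set.
    (let T = {m. length m = p \<and> set m \<subseteq> {0..l'} \<and> sum_list m = k} in
       {X \<in> Gr k n. (cyc_shift k n ^^ l) X = X} = (\<Union>m\<in>T. Y m) \<and>
       disjoint_family_on Y T \<and>
       (\<forall>m\<in>T. closedin (zariski (listset [plucker k n ` Gr k n])) (listset [plucker k n ` Y m]) \<and>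
          variety_isomorphic (listset [plucker k n ` Y m])
            (listset (map (\<lambda>r. plucker r l' ` Gr r l') m))))"
proof -
  define e where "e = l div l'"
  have l': "l' > 0" "l' dvd l" "l' dvd n" using assms by auto
  have n: "n = p * l'" and l: "l = l' * e" using l' assms by (simp_all add: e_def)
  have p: "p > 0" using n assms(1,2) by (cases p) simp_all
  have e: "e > 0" using l assms(3) by (cases e) simp_all
  have cop: "coprime e p" using div_gcd_coprime[of l n] assms by (simp add: e_def)
  obtain ev where ev: "inj_on ev {..<p}" "\<forall>i<p. ev i ^ p = (-1 :: complex) ^ (k - 1)"
    using ex_distinct_roots[OF p, of "(-1) ^ (k - 1)"] by auto
  interpret shift_eigenbasis k n p l' ev
    using n p l' ev by unfold_locales auto
  let ?T = "{m. length m = p \<and> set m \<subseteq> {0..l'} \<and> sum_list m = k}"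
  have inj: "inj_on (\<lambda>i. ev i ^ e) {..<p}"
    using inj_on_power_coprime[OF ev(1) _ _ cop e, of "(-1) ^ (k - 1)"] ev(2) by simp
  have "{X \<in> Gr k n. (cyc_shift k n ^^ l) X = X} = (\<Union>m\<in>?T. stratum m)"
  proof (intro equalityI subsetI)
    fix X assume "X \<in> {X \<in> Gr k n. (cyc_shift k n ^^ l) X = X}"
    then show "X \<in> (\<Union>m\<in>?T. stratum m)" using fixed_imp_stratum[of X e] inj l by auto
  next
    fix X assume "X \<in> (\<Union>m\<in>?T. stratum m)"
    then show "X \<in> {X \<in> Gr k n. (cyc_shift k n ^^ l) X = X}"
      using stratum_fixed[of X _ e] stratum_subset_Gr l by auto
  qed
  moreover have "disjoint_family_on stratum ?T"
    unfolding disjoint_family_on_def using stratum_disjoint by blast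
  ultimately show ?thesis
    unfolding Let_def using closedin_stratum variety_isomorphic_stratum
    by (intro exI[of _ stratum]) simp
qed

end
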